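(* Let $X$ be a finite non-empty set, $S=\Omega(X,\{1,2\})$, and let $C$ be an uncentered cell of $S$ with finite fanout that is dense in $S$. Let $\pi:S\to\{0,1\}^{\mathbb N}$ be a homeomorphism, and for $n\ge 0$ let $\pi_n(w)\in\{0,1\}^n$ be the first $n$ coordinates of $\pi(w)$ (with $\pi_0(w)$ the empty sequence, so $\pi_0^{-1}\circ\pi_0(w)=S$). Let $z\in C$, and for each $i\ge1$ let $z_i\in C$ satisfy $\pi_{2i-2}(z_i)=\pi_{2i-2}(z)$ and $\pi_{2i}(z_i)\neq\pi_{2i}(z)$. Define $A_{1,1}=S\setminus\big(\pi_2^{-1}\pi_2(z_1)\cup\pi_2^{-1}\pi_2(z)\big)$; for $1\le k<i$, $A_{i,k}=\pi_{2i-2}^{-1}\pi_{2i-2}(z_k)\setminus\pi_{2i}^{-1}\pi_{2i}(z_k)$; and for $i\ge 2$, $A_{i,i}=\pi_{2i-2}^{-1}\pi_{2i-2}(z)\setminus\big(\pi_{2i}^{-1}\pi_{2i}(z_i)\cup\pi_{2i}^{-1}\pi_{2i}(z)\big)$. (These sets are non-empty, pairwise disjoint, and their union is $S\setminus\{z,z_1,z_2,\dots\}$.) For each $i\ge1$ let ${\cal P}^i$ be a partition of $C\cap\bigcup_{k=1}^iA_{i,k}$ which is upper and lower hemi-continuous (in the relative topology) and each of whose members has exactly $i$ elements, exactly one in each $A_{i,k}$, $1\le k\le i$. Let ${\cal P}=\bigcup_{i\ge1}{\cal P}^i\cup\{\{z,z_1,z_2,\dots\}\}$, a partition of $C$, and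 let ${\cal A}$ be the Kripke structure $(C;\{1,2,3\};{\cal Q}^1|_C,{\cal Q}^2|_C,{\cal P};X;\psi|_C)$, where person $3$ has partition ${\cal P}$. Then $\phi^{\cal A}$ maps $C$ bijectively onto a cell of $\Omega(X,\{1,2,3\})$, and this cell is surjective but does not have finite fanout.
   Context: A Kripke structure ${\cal K}=(S;J;({\cal P}^j\mid j\in J);X;\psi)$ consists of a set $S$, a set $J$ of persons, a partition ${\cal P}^j$ of $S$ for each $j\in J$, a set $X$ of primitive propositions, and $\psi:S\to\{0,1\}^X$ (write $\psi^x(s)$ for the $x$-coordinate). A cell of ${\cal K}$ is a minimal non-empty subset $D\subseteq S$ such that for all $j$, $P\in{\cal P}^j$ and $P\cap D\ne\emptyset$ imply $P\subseteq D$. A cell has finite fanout if every $P\in{\cal P}^j$ ($j\in J$) contained in it is finite. Formulas ${\cal L}(X,J)$: each $x\in X$ is a formula; if $g,h$ are formulas then so are $\neg g$, $g\wedge h$, $k_jg$ ($j\in J$); nothing else. For a Kripke structure define $\alpha^{\cal K}(x)=\{s:\psi^x(s)=1\}$, $\alpha^{\cal K}(\neg g)=S\setminus\alpha^{\cal K}(g)$, $\alpha^{\cal K}(g\wedge h)=\alpha^{\cal K}(g)\cap\alpha^{\cal K}(h)$, $\alpha^{\cal K}(k_jg)=\{s: s\in P\in{\cal P}^j\Rightarrow P\subseteq\alpha^{\cal K}(g)\}$, and the canonical map $\phi^{\cal K}(s)=\{f: s\in\alpha^{\cal K}(f)\}$. $\Omega(X,J)$ is the set of complete and consistent subsets of ${\cal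 L}(X,J)$ for multi-agent S5 (axioms: substitution instances of tautologies, $(k_jf\wedge k_j(f\to g))\to k_jg$, $k_jf\to f$, $k_jf\to k_jk_jf$, $\neg k_jf\to k_j\neg k_jf$; rules modus ponens and necessitation). It is a Kripke structure with persons $J$, partitions ${\cal Q}^j$ given by the fibres of $\beta^j(w)=\{f: k_jf\in w\}$, and evaluation $\psi^x(w)=1$ iff $x\in w$. Its topology (the topology induced by the formulas) has base $\{w: f\in w\}$, $f\in{\cal L}(X,J)$; for $|J|\ge2$ and $X\neq\emptyset$ it is homeomorphic to the Cantor set $\{0,1\}^{\mathbb N}$. For a subset $C$, ${\cal Q}^j|_C=\{F\cap C: F\in{\cal Q}^j, F\cap C\ne\emptyset\}$ and $\psi|_C$ is the restriction. For a cell $D$ of $\Omega(X,J)$, its common-knowledge set is the set of formulas $f$ such that $k_{j_1}\cdots k_{j_n}f\in w$ for all $n\ge0$, all $j_1,\dots,j_n\in J$ and all $w\in D$; $D$ is centered if no other cell of $\Omega(X,J)$ has the same common-knowledge set, and uncentered otherwise. A cell $D$ of $\Omega(X,J)$ is surjective if every Kripke structure ${\cal K}$ with the same $X$ and $J$, non-empty state space $S'$, and $\phi^{\cal K}(S')\subseteq D$ satisfies $\phi^{\cal K}(S')=D$. A partition of a topological space is upper (resp. lower) hemi-continuous if the correspondence sending each point to the member containing it is upper (resp. lower) hemi-continuous in the usual sense of set-valued correspondences. *)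

theory Defs
  imports "HOL-Analysis.Analysis" "HOL-Library.Disjoint_Sets"
begin

subsection \<open>Formulas and Kripke structures\<close>

datatype ('x, 'j) fm =
    Atom 'x
  | Neg "('x, 'j) fm"
  | Conj "('x, 'j) fm" "('x, 'j) fm"
  | Know 'j "('x, 'j) fm"

primrec in_lang :: "'x set \<Rightarrow> 'j set \<Rightarrow> ('x, 'j) fm \<Rightarrow> bool" where
  "in_lang X J (Atom x) \<longleftrightarrow> x \<in> X"
| "in_lang X J (Neg g) \<longleftrightarrow> in_lang X J g"
| "in_lang X J (Conj g h) \<longleftrightarrow> in_lang X J g \<and> in_lang X J h"
| "in_lang X J (Know j g) \<longleftrightarrow> j \<in> J \<and> in_lang X J g"

definition lang :: "'x set \<Rightarrow> 'j set \<Rightarrow> ('x, 'j) fm set" where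
  "lang X J = {f. in_lang X J f}"

text \<open>The values of \<open>part\<close> off \<open>persons\<close>, and of \<open>val\<close> off \<open>states\<close> and \<open>props\<close>, are irrelevant.\<close>

record ('s, 'j, 'x) kripke =
  states :: "'s set"
  persons :: "'j set"
  part :: "'j \<Rightarrow> 's set set"
  props :: "'x set"
  val :: "'s \<Rightarrow> 'x \<Rightarrow> bool"

definition kripke_structure :: "('s, 'j, 'x) kripke \<Rightarrow> bool" where
  "kripke_structure K \<longleftrightarrow> (\<forall>j \<in> persons K. partition_on (states K) (part K j))"

definition saturated :: "('s, 'j, 'x) kripke \<Rightarrow> 's set \<Rightarrow> bool" where
  "saturated K D \<longleftrightarrow> D \<noteq> {} \<and> D \<subseteq> states K \<and>
     (\<forall>j \<in> persons K. \<forall>P \<in> part K j. P \<inter> D \<noteq> {} \<longrightarrow> P \<subseteq> D)"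

definition is_cell :: "('s, 'j, 'x) kripke \<Rightarrow> 's set \<Rightarrow> bool" where
  "is_cell K D \<longleftrightarrow> saturated K D \<and> (\<forall>D'. saturated K D' \<and> D' \<subseteq> D \<longrightarrow> D' = D)"

definition finite_fanout :: "('s, 'j, 'x) kripke \<Rightarrow> 's set \<Rightarrow> bool" where
  "finite_fanout K D \<longleftrightarrow> (\<forall>j \<in> persons K. \<forall>P \<in> part K j. P \<subseteq> D \<longrightarrow> finite P)"

primrec \<alpha> :: "('s, 'j, 'x) kripke \<Rightarrow> ('x, 'j) fm \<Rightarrow> 's set" where
  "\<alpha> K (Atom x) = {s \<in> states K. val K s x}"
| "\<alpha> K (Neg g) = states K - \<alpha> K g"
| "\<alpha> K (Conj g h) = \<alpha> K g \<inter> \<alpha> K h"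
| "\<alpha> K (Know j g) = {s \<in> states K. \<forall>P \<in> part K j. s \<in> P \<longrightarrow> P \<subseteq> \<alpha> K g}"

definition \<phi> :: "('s, 'j, 'x) kripke \<Rightarrow> 's \<Rightarrow> ('x, 'j) fm set" where
  "\<phi> K s = {f \<in> lang (props K) (persons K). s \<in> \<alpha> K f}"

subsection \<open>Multi-agent S5\<close>

datatype pform = PVar nat | PNeg pform | PConj pform pform

primrec peval :: "(nat \<Rightarrow> bool) \<Rightarrow> pform \<Rightarrow> bool" where
  "peval v (PVar n) \<longleftrightarrow> v n"
| "peval v (PNeg p) \<longleftrightarrow> \<not> peval v p"
| "peval v (PConj p q) \<longleftrightarrow> peval v p \<and> peval v q"

definition tautology :: "pform \<Rightarrow> bool" where
  "tautology p \<longleftrightarrow> (\<forall>v. peval v p)"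

primrec psubst :: "(nat \<Rightarrow> ('x, 'j) fm) \<Rightarrow> pform \<Rightarrow> ('x, 'j) fm" where
  "psubst \<sigma> (PVar n) = \<sigma> n"
| "psubst \<sigma> (PNeg p) = Neg (psubst \<sigma> p)"
| "psubst \<sigma> (PConj p q) = Conj (psubst \<sigma> p) (psubst \<sigma> q)"

abbreviation Imp :: "('x, 'j) fm \<Rightarrow> ('x, 'j) fm \<Rightarrow> ('x, 'j) fm" where
  "Imp f g \<equiv> Neg (Conj f (Neg g))"

inductive S5 :: "'x set \<Rightarrow> 'j set \<Rightarrow> ('x, 'j) fm \<Rightarrow> bool"
  for X :: "'x set" and J :: "'j set" where
  taut: "tautology p \<Longrightarrow> (\<And>n. \<sigma> n \<in> lang X J) \<Longrightarrow> S5 X J (psubst \<sigma> p)"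
| axK: "f \<in> lang X J \<Longrightarrow> g \<in> lang X J \<Longrightarrow> j \<in> J \<Longrightarrow>
    S5 X J (Imp (Conj (Know j f) (Know j (Imp f g))) (Know j g))"
| axT: "f \<in> lang X J \<Longrightarrow> j \<in> J \<Longrightarrow> S5 X J (Imp (Know j f) f)"
| ax4: "f \<in> lang X J \<Longrightarrow> j \<in> J \<Longrightarrow> S5 X J (Imp (Know j f) (Know j (Know j f)))"
| ax5: "f \<in> lang X J \<Longrightarrow> j \<in> J \<Longrightarrow>
    S5 X J (Imp (Neg (Know j f)) (Know j (Neg (Know j f))))"
| mp: "S5 X J f \<Longrightarrow> S5 X J (Imp f g) \<Longrightarrow> S5 X J g"
| nec: "S5 X J f \<Longrightarrow> j \<in> J \<Longrightarrow> S5 X J (Know j f)"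

text \<open>Derivability from a set of formulas: necessitation applies to theorems only.\<close>

definition derives :: "'x set \<Rightarrow> 'j set \<Rightarrow> ('x, 'j) fm set \<Rightarrow> ('x, 'j) fm \<Rightarrow> bool" where
  "derives X J w f \<longleftrightarrow> (\<exists>fs. set fs \<subseteq> w \<and> S5 X J (foldr Imp fs f))"

definition consistent :: "'x set \<Rightarrow> 'j set \<Rightarrow> ('x, 'j) fm set \<Rightarrow> bool" where
  "consistent X J w \<longleftrightarrow> \<not> (\<exists>f \<in> lang X J. derives X J w f \<and> derives X J w (Neg f))"

definition complete_fms :: "'x set \<Rightarrow> 'j set \<Rightarrow> ('x, 'j) fm set \<Rightarrow> bool" where
  "complete_fms X J w \<longleftrightarrow> (\<forall>f \<in> lang X J. f \<in> w \<or> Neg f \<in> w)"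

subsection \<open>The canonical structure\<close>

definition \<Omega> :: "'x set \<Rightarrow> 'j set \<Rightarrow> ('x, 'j) fm set set" where
  "\<Omega> X J = {w. w \<subseteq> lang X J \<and> complete_fms X J w \<and> consistent X J w}"

definition \<beta> :: "'j \<Rightarrow> ('x, 'j) fm set \<Rightarrow> ('x, 'j) fm set" where
  "\<beta> j w = {f. Know j f \<in> w}"

definition \<Q> :: "'x set \<Rightarrow> 'j set \<Rightarrow> 'j \<Rightarrow> ('x, 'j) fm set set set" where
  "\<Q> X J j = (\<lambda>w. {v \<in> \<Omega> X J. \<beta> j v = \<beta> j w}) ` \<Omega> X J"

definition \<Omega>_val :: "('x, 'j) fm set \<Rightarrow> 'x \<Rightarrow> bool" where
  "\<Omega>_val w x \<longleftrightarrow> Atom x \<in> w"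

definition \<Omega>_kripke :: "'x set \<Rightarrow> 'j set \<Rightarrow> (('x, 'j) fm set, 'j, 'x) kripke" where
  "\<Omega>_kripke X J =
    \<lparr>states = \<Omega> X J, persons = J, part = \<Q> X J, props = X, val = \<Omega>_val\<rparr>"

text \<open>The generating sets are closed under binary intersection, by \<open>Conj\<close>, so they form a base.\<close>

definition \<Omega>_top :: "'x set \<Rightarrow> 'j set \<Rightarrow> ('x, 'j) fm set topology" where
  "\<Omega>_top X J = topology_generated_by ((\<lambda>f. {w \<in> \<Omega> X J. f \<in> w}) ` lang X J)"

definition common_knowledge ::
  "'x set \<Rightarrow> 'j set \<Rightarrow> ('x, 'j) fm set set \<Rightarrow> ('x, 'j) fm set" where
  "common_knowledge X J D =
    {f \<in> lang X J. \<forall>js \<in> lists J. \<forall>w \<in> D. foldr Know js f \<in> w}"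

definition centered :: "'x set \<Rightarrow> 'j set \<Rightarrow> ('x, 'j) fm set set \<Rightarrow> bool" where
  "centered X J D \<longleftrightarrow>
    \<not> (\<exists>D'. is_cell (\<Omega>_kripke X J) D' \<and> D' \<noteq> D \<and>
         common_knowledge X J D' = common_knowledge X J D)"

text \<open>HOL cannot quantify over types inside a formula, so the type of the states of the
  competing Kripke structures is a parameter; a claim of surjectivity with a free type variable
  \<open>'s\<close> covers state spaces of every type.\<close>

definition surjective_cell ::
  "'s itself \<Rightarrow> 'x set \<Rightarrow> 'j set \<Rightarrow> ('x, 'j) fm set set \<Rightarrow> bool" where
  "surjective_cell TYPE('s) X J D \<longleftrightarrow>
    (\<forall>K :: ('s, 'j, 'x) kripke.
       kripke_structure K \<and> props K = X \<and> persons K = J \<and> states K \<noteq> {} \<and>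
       \<phi> K ` states K \<subseteq> D \<longrightarrow> \<phi> K ` states K = D)"

definition restrict_partition :: "'a set set \<Rightarrow> 'a set \<Rightarrow> 'a set set" where
  "restrict_partition Q C = {F \<inter> C | F. F \<in> Q \<and> F \<inter> C \<noteq> {}}"

subsection \<open>Hemi-continuity of partitions\<close>

definition upper_hemicontinuous ::
  "'a topology \<Rightarrow> 'b topology \<Rightarrow> ('a \<Rightarrow> 'b set) \<Rightarrow> bool" where
  "upper_hemicontinuous T U F \<longleftrightarrow>
    (\<forall>x \<in> topspace T. \<forall>V. openin U V \<and> F x \<subseteq> V \<longrightarrow>
       (\<exists>W. openin T W \<and> x \<in> W \<and> (\<forall>y \<in> W. F y \<subseteq> V)))"

definition lower_hemicontinuous ::
  "'a topology \<Rightarrow> 'b topology \<Rightarrow> ('a \<Rightarrow> 'b set) \<Rightarrow> bool" where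
  "lower_hemicontinuous T U F \<longleftrightarrow>
    (\<forall>x \<in> topspace T. \<forall>V. openin U V \<and> F x \<inter> V \<noteq> {} \<longrightarrow>
       (\<exists>W. openin T W \<and> x \<in> W \<and> (\<forall>y \<in> W. F y \<inter> V \<noteq> {})))"

definition member_of :: "'a set set \<Rightarrow> 'a \<Rightarrow> 'a set" where
  "member_of P x = (THE M. M \<in> P \<and> x \<in> M)"

definition upper_hemicontinuous_partition :: "'a topology \<Rightarrow> 'a set set \<Rightarrow> bool" where
  "upper_hemicontinuous_partition T P \<longleftrightarrow> upper_hemicontinuous T T (member_of P)"

definition lower_hemicontinuous_partition :: "'a topology \<Rightarrow> 'a set set \<Rightarrow> bool" where
  "lower_hemicontinuous_partition T P \<longleftrightarrow> lower_hemicontinuous T T (member_of P)"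

subsection \<open>The construction\<close>

definition cantor_top :: "(nat \<Rightarrow> bool) topology" where
  "cantor_top = product_topology (\<lambda>_. discrete_topology UNIV) UNIV"

definition first_coords :: "('a \<Rightarrow> nat \<Rightarrow> bool) \<Rightarrow> nat \<Rightarrow> 'a \<Rightarrow> bool list" where
  "first_coords \<pi> n w = map (\<pi> w) [0..<n]"

text \<open>The set \<open>\<pi>\<^sub>n\<^sup>-\<^sup>1(\<pi>\<^sub>n(w))\<close> for a map \<open>\<pi>\<close> with domain \<open>S\<close>.\<close>

definition cyl :: "'a set \<Rightarrow> ('a \<Rightarrow> nat \<Rightarrow> bool) \<Rightarrow> nat \<Rightarrow> 'a \<Rightarrow> 'a set" where
  "cyl S \<pi> n w = {v \<in> S. first_coords \<pi> n v = first_coords \<pi> n w}"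

text \<open>Meaningful for \<open>1 \<le> k \<le> i\<close> only; \<open>zs 0\<close> is never used.\<close>

definition A_set ::
  "'a set \<Rightarrow> ('a \<Rightarrow> nat \<Rightarrow> bool) \<Rightarrow> 'a \<Rightarrow> (nat \<Rightarrow> 'a) \<Rightarrow> nat \<Rightarrow> nat \<Rightarrow> 'a set" where
  "A_set S \<pi> z zs i k =
    (if k < i then cyl S \<pi> (2*i - 2) (zs k) - cyl S \<pi> (2*i) (zs k)
     else if i = 1 then S - (cyl S \<pi> 2 (zs 1) \<union> cyl S \<pi> 2 z)
     else cyl S \<pi> (2*i - 2) z - (cyl S \<pi> (2*i) (zs i) \<union> cyl S \<pi> (2*i) z))"

definition third_partition :: "(nat \<Rightarrow> 'a set set) \<Rightarrow> 'a \<Rightarrow> (nat \<Rightarrow> 'a) \<Rightarrow> 'a set set" where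
  "third_partition \<P> z zs = (\<Union>i \<in> {1..}. \<P> i) \<union> {insert z (zs ` {1..})}"

definition \<A>_kripke ::
  "'x set \<Rightarrow> ('x, nat) fm set set \<Rightarrow> ('x, nat) fm set set set \<Rightarrow>
   (('x, nat) fm set, nat, 'x) kripke" where
  "\<A>_kripke X C P =
    \<lparr>states = C, persons = {1, 2, 3},
     part = (\<lambda>j. if j = 3 then P else restrict_partition (\<Q> X {1, 2} j) C),
     props = X, val = restrict \<Omega>_val C\<rparr>"

end

theory Submission imports Defs begin

text \<open>
  The set \<open>{z, z\<^sub>1, \<dots>}\<close> has a decreasing clopen neighbourhood base in which the \<open>i\<close>-th layer is
  exactly the union of the \<open>A\<^sub>i\<^sub>k\<close>, so the third partition is upper and lower hemi-continuous
  also there. The other two partitions are hemi-continuous because \<open>C\<close> has finite fanout. Hence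
  every formula of the three-person language defines a relatively clopen subset of \<open>C\<close>, and since
  the information sets are compact, any point of the canonical space sharing its knowledge with
  some \<open>\<phi>(w)\<close> is itself some \<open>\<phi>(v)\<close>, with \<open>v\<close> in the information set of \<open>w\<close>. By the truth lemma
  \<open>\<phi>(w)\<close> extends \<open>w\<close>, which gives injectivity. Minimality and surjectivity use only the first two
  persons: the pullback to \<open>C\<close> of a saturated set, or of the image of a competing structure, is
  closed under their information sets (finitely many points can be separated by a formula), and
  \<open>C\<close> is a cell.
\<close>

text \<open>The obstacle is that person 3 has an infinite information set \<open>Z\<close>. In
  \<Omega>(X,{1,2,3}) the class of \<phi>(z) is the closure of \<phi>(Z) in the formula topology, so
  it might contain limits realised nowhere in \<open>C\<close>, and the image of \<open>C\<close>
  would then not be saturated. Images of finite information sets are closed for free. For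
  \<open>Z\<close>, closedness comes from compactness: the points \<open>zs k\<close> converge to
  \<open>z\<close>, and clopenness of the extents of formulas is the continuity of \<phi> on
  \<open>C\<close>.

  This explains the sets A_{i,k}. Finite information sets near \<open>Z\<close> have to approximate
  an infinite set, so their size must grow as they approach it. A member in layer \<open>i\<close>
  has one point close to each \<open>zs k\<close> with \<open>k < i\<close> (lower hemi-continuity)
  and lies wholly in a small neighbourhood of \<open>Z\<close> (upper hemi-continuity).

  A competing structure might fill an infinite class only densely, whereas a finite class must be
  filled, finite images being closed. Surjectivity survives because persons 1 and 2, whose classes
  stay finite, already connect the cell.\<close>

lemma partition_on_eqI:
  "partition_on A P \<Longrightarrow> M \<in> P \<Longrightarrow> N \<in> P \<Longrightarrow> x \<in> M \<Longrightarrow> x \<in> N \<Longrightarrow> M = N"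
  by (auto simp: partition_on_def disjoint_def)

lemma partition_on_ex: "partition_on A P \<Longrightarrow> x \<in> A \<Longrightarrow> \<exists>M\<in>P. x \<in> M"
  by (auto simp: partition_on_def)

lemma member_of_eq: "partition_on A P \<Longrightarrow> M \<in> P \<Longrightarrow> x \<in> M \<Longrightarrow> member_of P x = M"
  unfolding member_of_def by (rule the_equality) (auto dest: partition_on_eqI)

subsection \<open>Soundness\<close>

lemma \<alpha>_subset_states: "\<alpha> K f \<subseteq> states K"
  by (induction f) auto

lemma kripke_member_subset:
  "kripke_structure K \<Longrightarrow> j \<in> persons K \<Longrightarrow> P \<in> part K j \<Longrightarrow> P \<subseteq> states K"
  unfolding kripke_structure_def using partition_onD1 by blast

lemma \<alpha>_Know_iff:
  assumes "kripke_structure K" "j \<in> persons K" "P \<in> part K j" "s \<in> P"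
  shows "s \<in> \<alpha> K (Know j g) \<longleftrightarrow> P \<subseteq> \<alpha> K g"
proof -
  have "partition_on (states K) (part K j)"
    using assms(1,2) unfolding kripke_structure_def by blast
  moreover have "s \<in> states K"
    using kripke_member_subset[OF assms(1-3)] assms(4) by blast
  ultimately have "(\<forall>Q\<in>part K j. s \<in> Q \<longrightarrow> Q \<subseteq> \<alpha> K g) \<longleftrightarrow> P \<subseteq> \<alpha> K g"
    using assms(3,4) partition_on_eqI by metis
  then show ?thesis using \<open>s \<in> states K\<close> by simp
qed

lemma kripke_memberE:
  assumes "kripke_structure K" "j \<in> persons K" "s \<in> states K"
  obtains P where "P \<in> part K j" "s \<in> P" "P \<subseteq> states K"
  using assms partition_on_ex kripke_member_subset unfolding kripke_structure_def by metis

lemma S5_sound: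
  assumes K: "kripke_structure K" and "S5 X (persons K) f"
  shows "states K \<subseteq> \<alpha> K f"
  using assms(2)
proof induction
  case (taut p \<sigma>)
  have "s \<in> \<alpha> K (psubst \<sigma> p) \<longleftrightarrow> peval (\<lambda>n. s \<in> \<alpha> K (\<sigma> n)) p" if "s \<in> states K" for s
    using that by (induction p) auto
  then show ?case using taut by (auto simp: tautology_def)
next
  case (axK f g j)
  then show ?case by auto
next
  case (axT f j)
  show ?case
  proof
    fix s assume s: "s \<in> states K"
    obtain P where P: "P \<in> part K j" "s \<in> P" "P \<subseteq> states K"
      by (rule kripke_memberE[OF K \<open>j \<in> _\<close> s])
    show "s \<in> \<alpha> K (Imp (Know j f) f)"
      using s P by auto
  qed
next
  case (ax4 f j)
  show ?case
  proof
    fix s assume s: "s \<in> states K"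
    obtain P where P: "P \<in> part K j" "s \<in> P" "P \<subseteq> states K"
      by (rule kripke_memberE[OF K \<open>j \<in> _\<close> s])
    have "t \<in> \<alpha> K (Know j f) \<longleftrightarrow> P \<subseteq> \<alpha> K f" if "t \<in> P" for t
      by (rule \<alpha>_Know_iff[OF K \<open>j \<in> _\<close> P(1) that])
    moreover have "s \<in> \<alpha> K (Know j (Know j f)) \<longleftrightarrow> P \<subseteq> \<alpha> K (Know j f)"
      by (rule \<alpha>_Know_iff[OF K \<open>j \<in> _\<close> P(1,2)])
    ultimately have "s \<in> \<alpha> K (Know j f) \<Longrightarrow> s \<in> \<alpha> K (Know j (Know j f))"
      using P by blast
    then show "s \<in> \<alpha> K (Imp (Know j f) (Know j (Know j f)))"
      using s unfolding \<alpha>.simps(2,3) by blast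
  qed
next
  case (ax5 f j)
  show ?case
  proof
    fix s assume s: "s \<in> states K"
    obtain P where P: "P \<in> part K j" "s \<in> P" "P \<subseteq> states K"
      by (rule kripke_memberE[OF K \<open>j \<in> _\<close> s])
    have "t \<in> \<alpha> K (Know j f) \<longleftrightarrow> P \<subseteq> \<alpha> K f" if "t \<in> P" for t
      by (rule \<alpha>_Know_iff[OF K \<open>j \<in> _\<close> P(1) that])
    moreover have "s \<in> \<alpha> K (Know j (Neg (Know j f))) \<longleftrightarrow> P \<subseteq> \<alpha> K (Neg (Know j f))"
      by (rule \<alpha>_Know_iff[OF K \<open>j \<in> _\<close> P(1,2)])
    ultimately have "s \<notin> \<alpha> K (Know j f) \<Longrightarrow> s \<in> \<alpha> K (Know j (Neg (Know j f)))"
      using P unfolding \<alpha>.simps(2,3) by blast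
    then show "s \<in> \<alpha> K (Imp (Neg (Know j f)) (Know j (Neg (Know j f))))"
      using s unfolding \<alpha>.simps(2,3) by blast
  qed
next
  case (mp f g)
  then show ?case using \<alpha>_subset_states[of K f] by auto
next
  case (nec f j)
  then show ?case using kripke_member_subset[OF K] by fastforce
qed

text \<open>Completeness comes from \<open>Neg\<close> being the complement in
  \<open>states K\<close>. Consistency is soundness: whatever is derivable from formulas true at
  \<open>s\<close> is true at \<open>s\<close>, and no formula is true there together with its
  negation.\<close>

lemma \<phi>_in_\<Omega>:
  assumes K: "kripke_structure K" and s: "s \<in> states K"
  shows "\<phi> K s \<in> \<Omega> (props K) (persons K)"
proof -
  have fold: "s \<in> \<alpha> K f" if "s \<in> \<alpha> K (foldr Imp fs f)" "set fs \<subseteq> \<phi> K s" for fs f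
    using that s \<alpha>_subset_states[of K f]
    by (induction fs) (auto simp: \<phi>_def)
  have dv: "s \<in> \<alpha> K f" if d: "derives (props K) (persons K) (\<phi> K s) f" for f
  proof -
    obtain fs where fs: "set fs \<subseteq> \<phi> K s" "S5 (props K) (persons K) (foldr Imp fs f)"
      using d unfolding derives_def by blast
    show ?thesis
      using fold[OF _ fs(1)] S5_sound[OF K fs(2)] s by blast
  qed
  have "\<not> (derives (props K) (persons K) (\<phi> K s) f \<and>
      derives (props K) (persons K) (\<phi> K s) (Neg f))" for f
    using dv[of f] dv[of "Neg f"] by auto
  then have "consistent (props K) (persons K) (\<phi> K s)"
    unfolding consistent_def by blast
  then show ?thesis
    using s unfolding \<Omega>_def \<phi>_def complete_fms_def lang_def by auto
qed

subsection \<open>Propositional reasoning in S5\<close>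

text \<open>\<open>Know\<close> formulas are opaque here, like atoms. Truth under every
  \<open>v\<close> is a semantic test for being a substitution instance of a tautology, so
  propositional steps in S5 can be settled by evaluation.\<close>

primrec feval :: "(('x, 'j) fm \<Rightarrow> bool) \<Rightarrow> ('x, 'j) fm \<Rightarrow> bool" where
  "feval v (Atom x) \<longleftrightarrow> v (Atom x)"
| "feval v (Neg g) \<longleftrightarrow> \<not> feval v g"
| "feval v (Conj g h) \<longleftrightarrow> feval v g \<and> feval v h"
| "feval v (Know j g) \<longleftrightarrow> v (Know j g)"

primrec prop_atoms :: "('x, 'j) fm \<Rightarrow> ('x, 'j) fm set" where
  "prop_atoms (Atom x) = {Atom x}"
| "prop_atoms (Neg g) = prop_atoms g"
| "prop_atoms (Conj g h) = prop_atoms g \<union> prop_atoms h"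
| "prop_atoms (Know j g) = {Know j g}"

primrec to_pform :: "(('x, 'j) fm \<Rightarrow> nat) \<Rightarrow> ('x, 'j) fm \<Rightarrow> pform" where
  "to_pform e (Atom x) = PVar (e (Atom x))"
| "to_pform e (Neg g) = PNeg (to_pform e g)"
| "to_pform e (Conj g h) = PConj (to_pform e g) (to_pform e h)"
| "to_pform e (Know j g) = PVar (e (Know j g))"

lemma S5_feval:
  assumes f: "f \<in> lang X J" and valid: "\<And>v. feval v f"
  shows "S5 X J f"
proof -
  let ?A = "prop_atoms f"
  have "finite (prop_atoms g)" for g :: "('a, 'b) fm"
    by (induction g) auto
  \<comment> \<open>Only the finitely many atoms of \<open>f\<close> need distinct variables, so the
    types of propositions and persons may be uncountable.\<close>
  then obtain e :: "('a, 'b) fm \<Rightarrow> nat" where e: "inj_on e ?A"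
    using finite_imp_inj_to_nat_seg by metis
  \<comment> \<open>Off the range of \<open>e\<close> the value \<open>f\<close> is a mere default:
    \<open>taut\<close> wants \<open>\<sigma> n\<close> in the language for every
    \<open>n\<close>.\<close>
  define \<sigma> where "\<sigma> n = (if n \<in> e ` ?A then inv_into ?A e n else f)" for n
  have "prop_atoms g \<subseteq> lang X J" if "g \<in> lang X J" for g
    using that by (induction g) (auto simp: lang_def)
  then have \<sigma>_lang: "\<sigma> n \<in> lang X J" for n
    using f inv_into_into[of n e ?A] unfolding \<sigma>_def by auto
  have "psubst \<sigma> (to_pform e g) = g" if "prop_atoms g \<subseteq> ?A" for g
    using that e by (induction g) (auto simp: \<sigma>_def)
  then have subst: "psubst \<sigma> (to_pform e f) = f" by simp
  have "peval v (to_pform e g) = feval (v \<circ> e) g" for v and g :: "('a, 'b) fm"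
    by (induction g) auto
  then have "tautology (to_pform e f)"
    using valid by (simp add: tautology_def)
  then show ?thesis
    using S5.taut[of _ \<sigma>] \<sigma>_lang subst by metis
qed

lemma S5_in_lang: "S5 X J f \<Longrightarrow> f \<in> lang X J"
proof (induction rule: S5.induct)
  case (taut p \<sigma>)
  show ?case using taut(2) by (induction p) (auto simp: lang_def)
qed (auto simp: lang_def)

lemma S5_prop_consequence:
  assumes "S5 X J f" "g \<in> lang X J" "\<And>v. feval v f \<Longrightarrow> feval v g"
  shows "S5 X J g"
proof -
  have "S5 X J (Imp f g)"
    using assms S5_in_lang[OF assms(1)] by (intro S5_feval) (auto simp: lang_def)
  then show ?thesis using assms(1) S5.mp by blast
qed

lemma S5_prop_consequence2:
  assumes "S5 X J f" "S5 X J g" "h \<in> lang X J"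
    and "\<And>v. feval v f \<Longrightarrow> feval v g \<Longrightarrow> feval v h"
  shows "S5 X J h"
proof -
  have "S5 X J (Imp g h)"
    using assms S5_in_lang[OF assms(2)]
    by (intro S5_prop_consequence[OF assms(1)]) (auto simp: lang_def)
  then show ?thesis using assms(2) S5.mp by blast
qed

lemma feval_foldr_Imp:
  "feval v (foldr Imp fs f) \<longleftrightarrow> ((\<forall>g\<in>set fs. feval v g) \<longrightarrow> feval v f)"
  by (induction fs) auto

lemma foldr_Imp_in_lang:
  "foldr Imp fs f \<in> lang X J \<longleftrightarrow> set fs \<subseteq> lang X J \<and> f \<in> lang X J"
  by (induction fs) (auto simp: lang_def)

lemma derives_prop_consequence2:
  assumes "derives X J w f" "derives X J w g" "h \<in> lang X J"
    and "\<And>v. feval v f \<Longrightarrow> feval v g \<Longrightarrow> feval v h"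
  shows "derives X J w h"
proof -
  obtain fs gs where fs: "set fs \<subseteq> w" "S5 X J (foldr Imp fs f)"
    and gs: "set gs \<subseteq> w" "S5 X J (foldr Imp gs g)"
    using assms(1,2) unfolding derives_def by blast
  have "S5 X J (foldr Imp (fs @ gs) h)"
    using S5_in_lang[OF fs(2)] S5_in_lang[OF gs(2)] assms(3,4)
    by (intro S5_prop_consequence2[OF fs(2) gs(2)])
      (simp_all add: feval_foldr_Imp foldr_Imp_in_lang flip: foldr_append)
  then show ?thesis
    using fs(1) gs(1) unfolding derives_def by (intro exI[of _ "fs @ gs"]) auto
qed

lemma derives_mem:
  assumes "f \<in> w" "f \<in> lang X J" shows "derives X J w f"
  unfolding derives_def using assms
  by (intro exI[of _ "[f]"]) (auto intro!: S5_feval simp: lang_def)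

lemma derives_in_lang: "derives X J w f \<Longrightarrow> f \<in> lang X J"
  unfolding derives_def using S5_in_lang foldr_Imp_in_lang by blast

text \<open>As necessitation is confined to theorems, moving a premise into the conclusion is purely
  propositional. \<open>removeAll\<close> drops every occurrence of \<open>a\<close>, so that the
  remaining list has premises from \<open>w\<close> only.\<close>

lemma deduction:
  assumes "derives X J (insert a w) g" "a \<in> lang X J"
  shows "derives X J w (Imp a g)"
proof -
  obtain fs where fs: "set fs \<subseteq> insert a w" "S5 X J (foldr Imp fs g)"
    using assms(1) unfolding derives_def by blast
  have "S5 X J (foldr Imp (removeAll a fs) (Imp a g))"
    using S5_in_lang[OF fs(2)] assms(2)
    by (intro S5_prop_consequence[OF fs(2)])
      (auto simp: feval_foldr_Imp foldr_Imp_in_lang, auto simp: lang_def)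
  then show ?thesis
    using fs(1) unfolding derives_def by (intro exI[of _ "removeAll a fs"]) auto
qed

lemma inconsistent_insert:
  assumes "\<not> consistent X J (insert a w)" "a \<in> lang X J"
  shows "derives X J w (Neg a)"
proof -
  obtain f where f: "f \<in> lang X J" "derives X J (insert a w) f" "derives X J (insert a w) (Neg f)"
    using assms(1) unfolding consistent_def by blast
  show ?thesis
    using assms(2)
    by (intro derives_prop_consequence2[OF deduction[OF f(2)] deduction[OF f(3)]])
      (auto simp: lang_def)
qed

subsection \<open>Lindenbaum's lemma\<close>

lemma Lindenbaum:
  assumes "w \<subseteq> lang X J" "consistent X J w"
  obtains v where "v \<in> \<Omega> X J" "w \<subseteq> v"
proof -
  let ?F = "{v. w \<subseteq> v \<and> v \<subseteq> lang X J \<and> consistent X J v}"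
  have Zorn: "\<exists>M\<in>?F. \<forall>V\<in>?F. M \<subseteq> V \<longrightarrow> V = M"
  proof (rule subset_Zorn_nonempty)
    show "?F \<noteq> {}" using assms by blast
    fix c assume c: "c \<noteq> {}" "subset.chain ?F c"
    \<comment> \<open>A derivation uses a finite list of premises, so a single member of the chain
      contains them all.\<close>
    have "derives X J (\<Union>c) f \<Longrightarrow> \<exists>v\<in>c. derives X J v f" for f
    proof -
      assume "derives X J (\<Union>c) f"
      then obtain fs where fs: "set fs \<subseteq> \<Union>c" "S5 X J (foldr Imp fs f)"
        unfolding derives_def by blast
      have "\<exists>v\<in>c. set fs \<subseteq> v"
        by (rule finite_subset_Union_chain[OF _ fs(1) c]) auto
      then show ?thesis using fs(2) unfolding derives_def by blast
    qed
    moreover have "derives X J v f \<Longrightarrow> v \<subseteq> u \<Longrightarrow> derives X J u f" for u v f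
      unfolding derives_def by blast
    moreover have "u \<subseteq> v \<or> v \<subseteq> u" if "u \<in> c" "v \<in> c" for u v
      using c that unfolding subset.chain_def by blast
    ultimately have "\<exists>u\<in>c. derives X J u f \<and> derives X J u (Neg f)"
      if "derives X J (\<Union>c) f" "derives X J (\<Union>c) (Neg f)" for f
      using that by meson
    moreover have F: "w \<subseteq> u" "u \<subseteq> lang X J" "consistent X J u" if "u \<in> c" for u
      using c(2) that unfolding subset.chain_def by auto
    ultimately have "consistent X J (\<Union>c)"
      unfolding consistent_def by meson
    then show "\<Union>c \<in> ?F"
      using F c(1) by blast
  qed
  obtain M where "M \<in> ?F" and "\<forall>V\<in>?F. M \<subseteq> V \<longrightarrow> V = M"
    using Zorn by (rule bexE)
  then have M: "w \<subseteq> M" "M \<subseteq> lang X J" "consistent X J M"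
    and max: "\<And>V. w \<subseteq> V \<Longrightarrow> V \<subseteq> lang X J \<Longrightarrow> consistent X J V \<Longrightarrow> M \<subseteq> V \<Longrightarrow> V = M"
    by simp_all
  have "f \<in> M \<or> Neg f \<in> M" if f: "f \<in> lang X J" for f
  proof (rule ccontr)
    assume neg: "\<not> (f \<in> M \<or> Neg f \<in> M)"
    have Nf: "Neg f \<in> lang X J" using f by (simp add: lang_def)
    have "\<not> consistent X J (insert f M)"
    proof
      assume "consistent X J (insert f M)"
      then have "insert f M = M" using M f by (intro max) auto
      then show False using neg by auto
    qed
    moreover have "\<not> consistent X J (insert (Neg f) M)"
    proof
      assume "consistent X J (insert (Neg f) M)"
      then have "insert (Neg f) M = M" using M Nf by (intro max) auto
      then show False using neg by auto
    qed
    ultimately have "derives X J M (Neg f)" "derives X J M (Neg (Neg f))"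
      using inconsistent_insert f Nf by blast+
    then show False
      using M(3) Nf unfolding consistent_def by blast
  qed
  then have "M \<in> \<Omega> X J"
    using M unfolding \<Omega>_def complete_fms_def by blast
  then show ?thesis using that M(1) by blast
qed

subsection \<open>The canonical structure\<close>

lemma \<Omega>_in_lang: "w \<in> \<Omega> X J \<Longrightarrow> f \<in> w \<Longrightarrow> f \<in> lang X J"
  by (auto simp: \<Omega>_def)

lemma \<Omega>_derives:
  assumes w: "w \<in> \<Omega> X J" and f: "derives X J w f"
  shows "f \<in> w"
proof (rule ccontr)
  assume "f \<notin> w"
  then have "Neg f \<in> w"
    using w derives_in_lang[OF f] by (auto simp: \<Omega>_def complete_fms_def)
  then have "derives X J w (Neg f)"
    using derives_mem \<Omega>_in_lang[OF w] by blast
  then show False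
    using w f derives_in_lang[OF f] unfolding \<Omega>_def consistent_def by blast
qed

lemma \<Omega>_Neg:
  assumes "w \<in> \<Omega> X J" "f \<in> lang X J"
  shows "Neg f \<in> w \<longleftrightarrow> f \<notin> w"
proof -
  have "\<not> (derives X J w f \<and> derives X J w (Neg f))"
    using assms unfolding \<Omega>_def consistent_def by blast
  then have "\<not> (f \<in> w \<and> Neg f \<in> w)"
    using derives_mem \<Omega>_in_lang[OF assms(1)] by blast
  then show ?thesis
    using assms by (auto simp: \<Omega>_def complete_fms_def)
qed

lemma \<Omega>_Conj:
  assumes w: "w \<in> \<Omega> X J" and fg: "f \<in> lang X J" "g \<in> lang X J"
  shows "Conj f g \<in> w \<longleftrightarrow> f \<in> w \<and> g \<in> w"
proof -
  have c: "Conj f g \<in> lang X J" using fg by (simp add: lang_def)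
  have "f \<in> w" "g \<in> w" if "Conj f g \<in> w"
    using derives_mem[OF that c] fg
    by (auto intro!: \<Omega>_derives[OF w] derives_prop_consequence2[of X J w "Conj f g" "Conj f g"])
  moreover have "Conj f g \<in> w" if "f \<in> w" "g \<in> w"
    by (rule \<Omega>_derives[OF w], rule derives_prop_consequence2[of X J w f g])
      (use that fg c in \<open>auto intro: derives_mem\<close>)
  ultimately show ?thesis by blast
qed

lemma \<Omega>_mp:
  assumes w: "w \<in> \<Omega> X J" and "S5 X J (Imp f g)" "f \<in> w"
  shows "g \<in> w"
  using assms by (intro \<Omega>_derives[OF w]) (auto simp: derives_def intro!: exI[of _ "[f]"])

lemma \<Omega>_S5:
  assumes w: "w \<in> \<Omega> X J" and "S5 X J f"
  shows "f \<in> w"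
  using assms by (intro \<Omega>_derives[OF w]) (auto simp: derives_def intro!: exI[of _ "[]"])

text \<open>Maximality: a formula of \<open>v\<close> outside \<open>w\<close> would have its
  negation in \<open>w\<close>, hence in \<open>v\<close>.\<close>

lemma \<Omega>_eqI:
  assumes "w \<in> \<Omega> X J" "v \<in> \<Omega> X J" "w \<subseteq> v"
  shows "w = v"
proof -
  have "f \<in> w" if "f \<in> v" for f
    using \<Omega>_Neg[OF assms(1)] \<Omega>_Neg[OF assms(2)] \<Omega>_in_lang[OF assms(2) that] that assms(3) by blast
  then show ?thesis using assms(3) by blast
qed

text \<open>Axiom K iterated along a list of premises; it makes \<open>\<beta> j w\<close> closed
  under derivation.\<close>

lemma \<Omega>_Know_foldr:
  assumes w: "w \<in> \<Omega> X J" and j: "j \<in> J"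
    and "Know j (foldr Imp fs f) \<in> w" "\<forall>g\<in>set fs. Know j g \<in> w"
  shows "Know j f \<in> w"
  using assms(3,4)
proof (induction fs)
  case (Cons a fs)
  let ?R = "foldr Imp fs f"
  have K: "Know j a \<in> w" "Know j (Imp a ?R) \<in> w" using Cons.prems by auto
  then have l: "a \<in> lang X J" "?R \<in> lang X J"
    using \<Omega>_in_lang[OF w] by (fastforce simp: lang_def)+
  have "Conj (Know j a) (Know j (Imp a ?R)) \<in> w"
    using K \<Omega>_Conj[OF w] \<Omega>_in_lang[OF w] by blast
  then have "Know j ?R \<in> w"
    using \<Omega>_mp[OF w S5.axK[OF l j]] by blast
  then show ?case using Cons by simp
qed simp

text \<open>If \<open>Neg f\<close> were inconsistent with what \<open>j\<close> knows at
  \<open>w\<close>, then \<open>f\<close> would be derivable from known formulas and so be known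
  itself. Hence Lindenbaum's lemma provides \<open>v\<close>.\<close>

lemma \<Omega>_Know_witness:
  assumes w: "w \<in> \<Omega> X J" and j: "j \<in> J" and f: "f \<in> lang X J" "Know j f \<notin> w"
  obtains v where "v \<in> \<Omega> X J" "\<beta> j v = \<beta> j w" "f \<notin> v"
proof -
  have \<beta>_lang: "g \<in> lang X J" if "Know j g \<in> w" for g
    using \<Omega>_in_lang[OF w that] by (simp add: lang_def)
  have Nf: "Neg f \<in> lang X J" using f by (simp add: lang_def)
  have "consistent X J (insert (Neg f) (\<beta> j w))"
  proof (rule ccontr)
    assume "\<not> ?thesis"
    then have "derives X J (\<beta> j w) (Neg (Neg f))"
      using inconsistent_insert Nf by blast
    then have "derives X J (\<beta> j w) f"
      using f by (auto intro: derives_prop_consequence2[of X J _ "Neg (Neg f)" "Neg (Neg f)" f])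
    then obtain fs where "set fs \<subseteq> \<beta> j w" "S5 X J (foldr Imp fs f)"
      unfolding derives_def by blast
    then have "Know j (foldr Imp fs f) \<in> w" "\<forall>g\<in>set fs. Know j g \<in> w"
      using \<Omega>_S5[OF w S5.nec[OF _ j]] by (auto simp: \<beta>_def)
    then have "Know j f \<in> w"
      by (rule \<Omega>_Know_foldr[OF w j])
    then show False using f by simp
  qed
  moreover have "insert (Neg f) (\<beta> j w) \<subseteq> lang X J"
    using \<beta>_lang Nf unfolding \<beta>_def by blast
  ultimately obtain v where v: "v \<in> \<Omega> X J" "insert (Neg f) (\<beta> j w) \<subseteq> v"
    using Lindenbaum by metis
  have "f \<notin> v" using v \<Omega>_Neg[OF v(1) f(1)] by blast
  \<comment> \<open>Lindenbaum only gives \<open>\<beta> j w \<subseteq> v\<close>. Positive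
    introspection at \<open>w\<close> yields one direction and negative introspection the other, so
    that \<open>v\<close> lies in the class of \<open>w\<close> and is not merely accessible from
    it.\<close>
  moreover have "Know j g \<in> v \<longleftrightarrow> Know j g \<in> w" for g
  proof
    assume "Know j g \<in> w"
    then have "Know j (Know j g) \<in> w"
      using \<Omega>_mp[OF w S5.ax4[OF \<beta>_lang j]] by blast
    then show "Know j g \<in> v" using v unfolding \<beta>_def by blast
  next
    assume gv: "Know j g \<in> v"
    then have K: "Know j g \<in> lang X J" using \<Omega>_in_lang[OF v(1)] by blast
    then have g: "g \<in> lang X J" by (simp add: lang_def)
    show "Know j g \<in> w"
    proof (rule ccontr)
      assume "Know j g \<notin> w"
      then have "Know j (Neg (Know j g)) \<in> w"
        using \<Omega>_mp[OF w S5.ax5[OF g j]] \<Omega>_Neg[OF w K] by blast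
      then have "Neg (Know j g) \<in> v" using v unfolding \<beta>_def by blast
      then show False using \<Omega>_Neg[OF v(1) K] gv by blast
    qed
  qed
  ultimately show ?thesis using that v(1) unfolding \<beta>_def by blast
qed

lemma \<Omega>_Know_iff:
  assumes w: "w \<in> \<Omega> X J" and j: "j \<in> J" and f: "f \<in> lang X J"
  shows "Know j f \<in> w \<longleftrightarrow> (\<forall>v\<in>\<Omega> X J. \<beta> j v = \<beta> j w \<longrightarrow> f \<in> v)"
proof -
  have "f \<in> v" if "Know j f \<in> w" "v \<in> \<Omega> X J" "\<beta> j v = \<beta> j w" for v
    using \<Omega>_mp[OF that(2) S5.axT[OF f j]] that unfolding \<beta>_def by blast
  moreover have "\<exists>v\<in>\<Omega> X J. \<beta> j v = \<beta> j w \<and> f \<notin> v" if "Know j f \<notin> w"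
    by (rule \<Omega>_Know_witness[OF w j f that]) auto
  ultimately show ?thesis by auto
qed

lemma partition_on_\<Q>: "partition_on (\<Omega> X J) (\<Q> X J j)"
proof (rule partition_onI)
  show "\<Union> (\<Q> X J j) = \<Omega> X J" "{} \<notin> \<Q> X J j"
    unfolding \<Q>_def by blast+
  fix p q assume "p \<in> \<Q> X J j" "q \<in> \<Q> X J j" "p \<noteq> q"
  then obtain v w where pq: "p = {u \<in> \<Omega> X J. \<beta> j u = \<beta> j v}" "q = {u \<in> \<Omega> X J. \<beta> j u = \<beta> j w}"
    unfolding \<Q>_def by blast
  then have "\<beta> j v \<noteq> \<beta> j w" using \<open>p \<noteq> q\<close> by metis
  then show "disjnt p q" unfolding pq disjnt_def by force
qed

subsection \<open>Cylinders in the Cantor set\<close>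

lemma cantor_cylinder_clopen:
  "openin cantor_top {c. \<forall>i<n. c i = b i} \<and> closedin cantor_top {c. \<forall>i<n. c i = b i}"
proof (induction n)
  case 0
  have "topspace cantor_top = UNIV" by (simp add: cantor_top_def)
  then show ?case
    using openin_topspace[of cantor_top] closedin_topspace[of cantor_top] by simp
next
  case (Suc n)
  have cont: "continuous_map cantor_top (discrete_topology UNIV) (\<lambda>c. c n)"
    unfolding cantor_top_def by (rule continuous_map_product_projection) simp
  have eq: "{c \<in> topspace cantor_top. c n \<in> {b n}} = {c. c n = b n}"
    by (simp add: cantor_top_def)
  have "openin cantor_top {c. c n = b n}" "closedin cantor_top {c. c n = b n}"
    using openin_continuous_map_preimage[OF cont, of "{b n}"]
      closedin_continuous_map_preimage[OF cont, of "{b n}"] unfolding eq by simp_all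
  moreover have "{c. \<forall>i<Suc n. c i = b i} = {c. \<forall>i<n. c i = b i} \<inter> {c. c n = b n}"
    by (auto simp: less_Suc_eq)
  ultimately show ?case using Suc by auto
qed

lemma cantor_cylinder_base:
  assumes "openin cantor_top U" "b \<in> U"
  obtains n where "{c. \<forall>i<n. c i = b i} \<subseteq> U"
proof -
  obtain V where V: "finite {i. V i \<noteq> UNIV}" "b \<in> Pi\<^sub>E UNIV V" "Pi\<^sub>E UNIV V \<subseteq> U"
    using assms unfolding cantor_top_def openin_product_topology_alt by (auto; metis)
  obtain n where n: "\<And>i. V i \<noteq> UNIV \<Longrightarrow> i < n"
    using finite_nat_set_iff_bounded V(1) by auto
  have "c \<in> U" if "\<forall>i<n. c i = b i" for c
  proof -
    have "c i \<in> V i" for i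
      using that V(2) n[of i] by (cases "V i = UNIV") (auto simp: PiE_iff)
    then have "c \<in> Pi\<^sub>E UNIV V" by (simp add: PiE_iff)
    then show ?thesis by (rule subsetD[OF V(3)])
  qed
  then have "{c. \<forall>i<n. c i = b i} \<subseteq> U" by auto
  then show ?thesis by (rule that)
qed

lemma mem_cyl: "v \<in> cyl S \<pi> n w \<longleftrightarrow> v \<in> S \<and> (\<forall>i<n. \<pi> v i = \<pi> w i)"
  by (auto simp: cyl_def first_coords_def)

lemma cyl_clopen:
  assumes "homeomorphic_map T cantor_top \<pi>"
  shows "openin T (cyl (topspace T) \<pi> n w)" "closedin T (cyl (topspace T) \<pi> n w)"
proof -
  have cont: "continuous_map T cantor_top \<pi>"
    using assms homeomorphic_imp_continuous_map by blast
  have eq: "{v \<in> topspace T. \<pi> v \<in> {c. \<forall>i<n. c i = \<pi> w i}} = cyl (topspace T) \<pi> n w"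
    by (auto simp: mem_cyl)
  show "openin T (cyl (topspace T) \<pi> n w)" "closedin T (cyl (topspace T) \<pi> n w)"
    using openin_continuous_map_preimage[OF cont] closedin_continuous_map_preimage[OF cont]
      cantor_cylinder_clopen[of n "\<pi> w"] unfolding eq[symmetric] by blast+
qed

text \<open>The length is \<open>2 * n\<close> because the construction uses cylinders of even
  length; the longer cylinder is contained in that of length \<open>n\<close>.\<close>

lemma cyl_base:
  assumes \<pi>: "homeomorphic_map T cantor_top \<pi>" and "openin T V" "w \<in> V"
  obtains n where "cyl (topspace T) \<pi> (2 * n) w \<subseteq> V"
proof -
  have V: "V \<subseteq> topspace T" using assms openin_subset by blast
  have "openin cantor_top (\<pi> ` V)"
    using \<pi> V assms(2) homeomorphic_map_openness by blast
  then obtain n where n: "{c. \<forall>i<n. c i = \<pi> w i} \<subseteq> \<pi> ` V"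
    using cantor_cylinder_base[of "\<pi> ` V" "\<pi> w"] assms(3) by auto
  have inj: "inj_on \<pi> (topspace T)"
    using \<pi> by (simp add: homeomorphic_eq_everything_map)
  have "v \<in> V" if v: "v \<in> cyl (topspace T) \<pi> (2 * n) w" for v
  proof -
    have "\<pi> v \<in> \<pi> ` V" using n v by (auto simp: mem_cyl)
    then show ?thesis
      using inj V v by (auto simp: mem_cyl inj_on_def)
  qed
  then have "cyl (topspace T) \<pi> (2 * n) w \<subseteq> V" by (rule subsetI)
  then show ?thesis by (rule that)
qed

subsection \<open>The third partition\<close>

text \<open>The topological half of the construction, detached from logic: \<open>T\<close> is any
  space homeomorphic to the Cantor set.\<close>

locale cylinder_construction =
  fixes T :: "'a topology" and C :: "'a set" and \<pi> :: "'a \<Rightarrow> nat \<Rightarrow> bool"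
    and z :: 'a and zs :: "nat \<Rightarrow> 'a" and \<P> :: "nat \<Rightarrow> 'a set set"
  assumes homeo: "homeomorphic_map T cantor_top \<pi>"
    and C_subset: "C \<subseteq> topspace T"
    and z: "z \<in> C"
    and zs: "i \<ge> 1 \<Longrightarrow> zs i \<in> C"
    and zs_agree: "i \<ge> 1 \<Longrightarrow>
      first_coords \<pi> (2*i - 2) (zs i) = first_coords \<pi> (2*i - 2) z"
    and zs_differ: "i \<ge> 1 \<Longrightarrow> first_coords \<pi> (2*i) (zs i) \<noteq> first_coords \<pi> (2*i) z"
    and \<P>_partition: "i \<ge> 1 \<Longrightarrow>
      partition_on (C \<inter> (\<Union>k\<in>{1..i}. A_set (topspace T) \<pi> z zs i k)) (\<P> i)"
    and \<P>_upper: "i \<ge> 1 \<Longrightarrow> upper_hemicontinuous_partition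
      (subtopology T (C \<inter> (\<Union>k\<in>{1..i}. A_set (topspace T) \<pi> z zs i k))) (\<P> i)"
    and \<P>_lower: "i \<ge> 1 \<Longrightarrow> lower_hemicontinuous_partition
      (subtopology T (C \<inter> (\<Union>k\<in>{1..i}. A_set (topspace T) \<pi> z zs i k))) (\<P> i)"
    and \<P>_meets: "i \<ge> 1 \<Longrightarrow> M \<in> \<P> i \<Longrightarrow> k \<in> {1..i} \<Longrightarrow>
      \<exists>!w. w \<in> M \<inter> A_set (topspace T) \<pi> z zs i k"
begin

abbreviation cy :: "nat \<Rightarrow> 'a \<Rightarrow> 'a set" where
  "cy \<equiv> cyl (topspace T) \<pi>"

abbreviation Z :: "'a set" where
  "Z \<equiv> insert z (zs ` {1..})"

definition B :: "nat \<Rightarrow> 'a set" where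
  "B i = (\<Union>k\<in>{1..i}. A_set (topspace T) \<pi> z zs i k)"

text \<open>The sets \<open>E m\<close> form a decreasing clopen neighbourhood base of the compact set \<open>Z\<close>, and
  \<open>B i\<close> is the layer between two consecutive ones; this is what makes the third partition
  hemi-continuous at \<open>Z\<close>.\<close>

definition E :: "nat \<Rightarrow> 'a set" where
  "E m = cy (2*m) z \<union> (\<Union>k\<in>{1..m}. cy (2*m) (zs k))"

section \<open>Cylinders around \<open>z\<close> and the points \<open>zs k\<close>\<close>

lemma zs_coord: "1 \<le> k \<Longrightarrow> i < 2*k - 2 \<Longrightarrow> \<pi> (zs k) i = \<pi> z i"
  using zs_agree[of k] by (auto simp: first_coords_def)

lemma zs_coord_differs:
  assumes "1 \<le> k" obtains i where "i < 2*k" "\<pi> (zs k) i \<noteq> \<pi> z i"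
proof -
  have "\<exists>i<2*k. \<pi> (zs k) i \<noteq> \<pi> z i"
    using zs_differ[OF assms] unfolding first_coords_def by auto
  then show ?thesis using that by blast
qed

lemma Z_subset: "Z \<subseteq> C"
  using z zs by auto

lemma cy_antimono: "m \<le> n \<Longrightarrow> cy n w \<subseteq> cy m w"
  by (auto simp: mem_cyl)

text \<open>\<open>zs k\<close> shares its first \<open>2*k - 2\<close> coordinates with
  \<open>z\<close>, and \<open>m < k\<close> means \<open>2*m \<le> 2*k - 2\<close>. At level
  \<open>m\<close> the points \<open>zs k\<close> with \<open>k > m\<close> thus look like
  \<open>z\<close>, which is why \<open>E m\<close> needs only the centres \<open>z\<close> and
  \<open>zs 1\<close> to \<open>zs m\<close>.\<close>

lemma cy_zs: "m < k \<Longrightarrow> cy (2*m) (zs k) = cy (2*m) z"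
  using zs_coord[of k] by (auto simp: mem_cyl)

lemma cy_disjoint_z:
  assumes "1 \<le> k" "k \<le> m" shows "cy (2*m) (zs k) \<inter> cy (2*m) z = {}"
proof -
  obtain i where "i < 2*k" "\<pi> (zs k) i \<noteq> \<pi> z i" using zs_coord_differs assms by blast
  moreover have "i < 2*m" using \<open>i < 2*k\<close> assms by simp
  ultimately show ?thesis by (auto simp: mem_cyl)
qed

lemma cy_disjoint_zs:
  assumes "1 \<le> k" "k \<le> m" "1 \<le> l" "k \<noteq> l"
  shows "cy (2*m) (zs k) \<inter> cy (2*m) (zs l) = {}"
proof -
  \<comment> \<open>At length \<open>2*k\<close> the point \<open>zs l\<close> with
    \<open>l > k\<close> still looks like \<open>z\<close>, whose cylinder misses that of
    \<open>zs k\<close>; longer cylinders only shrink.\<close>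
  have *: "cy (2*m) (zs k) \<inter> cy (2*m) (zs l) = {}" if "1 \<le> k" "k \<le> m" "k < l" for k l
    using cy_antimono[of "2*k" "2*m"] cy_disjoint_z[of k k] cy_zs[of k l] that
    by (metis (no_types, lifting) Int_mono mult_le_mono2 order_refl subset_empty)
  show ?thesis
  proof (cases "k < l")
    case True
    then show ?thesis using * assms by blast
  next
    case False
    then show ?thesis using *[of l k] assms by auto
  qed
qed

lemma A_lower:
  "1 \<le> k \<Longrightarrow> k \<le> m \<Longrightarrow> A_set (topspace T) \<pi> z zs (Suc m) k = cy (2*m) (zs k) - cy (2*Suc m) (zs k)"
  by (simp add: A_set_def)

text \<open>The separate clause of \<open>A_set\<close> for \<open>i = 1\<close> fits the general
  pattern because the cylinder of length 0 is the whole space, so \<open>m = 0\<close> is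
  covered.\<close>

lemma A_diag:
  "A_set (topspace T) \<pi> z zs (Suc m) (Suc m) =
     cy (2*m) z - (cy (2*Suc m) (zs (Suc m)) \<union> cy (2*Suc m) z)"
  by (auto simp: A_set_def cyl_def first_coords_def numeral_2_eq_2)

text \<open>\<open>E m\<close> consists of \<open>m + 1\<close> disjoint cylinders. Each loses the
  cylinder about its centre that is longer by two; that of \<open>z\<close> also loses the cylinder
  of \<open>zs (Suc m)\<close>, which splits off from \<open>z\<close> at this level. The lost
  pieces make up \<open>E (Suc m)\<close>, and disjointness keeps a piece lost by one cylinder out
  of the others.\<close>

lemma B_eq: "B (Suc m) = E m - E (Suc m)"
proof -
  have B: "B (Suc m) = (\<Union>k\<in>{1..m}. cy (2*m) (zs k) - cy (2*Suc m) (zs k)) \<union>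
      (cy (2*m) z - (cy (2*Suc m) (zs (Suc m)) \<union> cy (2*Suc m) z))"
  proof -
    have "{1..Suc m} = insert (Suc m) {1..m}" by auto
    then show ?thesis
      unfolding B_def using A_lower[of _ m] A_diag[of m] by auto
  qed
  have E': "E (Suc m) = cy (2*Suc m) z \<union> cy (2*Suc m) (zs (Suc m)) \<union>
      (\<Union>k\<in>{1..m}. cy (2*Suc m) (zs k))"
  proof -
    have "{1..Suc m} = insert (Suc m) {1..m}" by auto
    then show ?thesis unfolding E_def by auto
  qed
  have sub: "cy (2*Suc m) w \<subseteq> cy (2*m) w" for w by (rule cy_antimono) simp
  have top: "cy (2*m) (zs (Suc m)) = cy (2*m) z" by (rule cy_zs) simp
  show ?thesis
  proof
    show "E m - E (Suc m) \<subseteq> B (Suc m)"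
      unfolding B E' unfolding E_def by blast
    show "B (Suc m) \<subseteq> E m - E (Suc m)"
    proof
      fix v assume "v \<in> B (Suc m)"
      then consider k where "k \<in> {1..m}" "v \<in> cy (2*m) (zs k)" "v \<notin> cy (2*Suc m) (zs k)"
        | "v \<in> cy (2*m) z" "v \<notin> cy (2*Suc m) (zs (Suc m))" "v \<notin> cy (2*Suc m) z"
        unfolding B by blast
      then show "v \<in> E m - E (Suc m)"
      proof cases
        case 1
        have "v \<notin> cy (2*m) z" using cy_disjoint_z[of k m] 1 by auto
        moreover have "v \<notin> cy (2*Suc m) (zs l)" if "l \<in> {1..m}" for l
          using cy_disjoint_zs[of k m l] 1 that sub[of "zs l"] by (cases "k = l") auto
        ultimately have "v \<notin> E (Suc m)"
          unfolding E' using sub[of z] sub[of "zs (Suc m)"] top by blast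
        then show ?thesis using 1 unfolding E_def by blast
      next
        case 2
        have "v \<notin> cy (2*Suc m) (zs l)" if "l \<in> {1..m}" for l
          using cy_disjoint_z[of l m] 2 that sub[of "zs l"] by auto
        then have "v \<notin> E (Suc m)"
          unfolding E' using 2 by blast
        then show ?thesis using 2 unfolding E_def by blast
      qed
    qed
  qed
qed

lemma E_0: "E 0 = topspace T"
  by (auto simp: E_def mem_cyl)

lemma E_antimono: "m \<le> n \<Longrightarrow> E n \<subseteq> E m"
proof -
  have "E (Suc m) \<subseteq> E m" for m
  proof
    fix v assume "v \<in> E (Suc m)"
    then have "v \<in> cy (2*Suc m) z \<or> (\<exists>k\<in>{1..Suc m}. v \<in> cy (2*Suc m) (zs k))"
      unfolding E_def by blast
    moreover have "cy (2*Suc m) w \<subseteq> cy (2*m) w" for w by (rule cy_antimono) simp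
    ultimately have "v \<in> cy (2*m) z \<or> (\<exists>k\<in>{1..Suc m}. v \<in> cy (2*m) (zs k))" by blast
    moreover have "cy (2*m) (zs (Suc m)) = cy (2*m) z" by (rule cy_zs) simp
    ultimately show "v \<in> E m" unfolding E_def by (auto simp: le_Suc_eq)
  qed
  then show "m \<le> n \<Longrightarrow> E n \<subseteq> E m" by (rule lift_Suc_antimono_le)
qed

lemma Z_subset_E: "Z \<subseteq> E m"
proof -
  have "z \<in> E m" using z C_subset by (auto simp: E_def mem_cyl)
  moreover have "zs k \<in> E m" if "1 \<le> k" for k
  proof (cases "k \<le> m")
    case True
    then show ?thesis using that zs[OF that] C_subset by (auto simp: E_def mem_cyl)
  next
    case False
    then have "cy (2*m) (zs k) = cy (2*m) z" by (intro cy_zs) simp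
    moreover have "zs k \<in> cy (2*m) (zs k)" using zs[OF that] C_subset by (auto simp: mem_cyl)
    ultimately show ?thesis unfolding E_def by blast
  qed
  ultimately show ?thesis by auto
qed

lemma eq_if_cy:
  assumes "v \<in> topspace T" "w \<in> topspace T" "\<And>n. n \<ge> m \<Longrightarrow> v \<in> cy (2*n) w"
  shows "v = w"
proof -
  have "\<pi> v i = \<pi> w i" for i
    using assms(3)[of "m + Suc i"] by (auto simp: mem_cyl)
  then have "\<pi> v = \<pi> w" by blast
  moreover have "inj_on \<pi> (topspace T)"
    using homeo by (simp add: homeomorphic_eq_everything_map)
  ultimately show ?thesis using assms(1,2) by (simp add: inj_on_def)
qed

text \<open>A point in a cylinder of \<open>zs k\<close> at some level \<open>m \<ge> k\<close> is
  cut off from all other centres, so it stays with \<open>zs k\<close> at every later level and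
  equals it. A point to which this never happens stays with \<open>z\<close>.\<close>

lemma Inter_E_subset:
  assumes v: "\<And>m. v \<in> E m" shows "v \<in> Z"
proof (cases "\<exists>m k. 1 \<le> k \<and> k \<le> m \<and> v \<in> cy (2*m) (zs k)")
  case True
  then obtain m k where k: "1 \<le> k" "k \<le> m" "v \<in> cy (2*m) (zs k)" by blast
  have "v \<in> cy (2*n) (zs k)" if n: "m \<le> n" for n
  proof -
    have sub: "cy (2*n) w \<subseteq> cy (2*m) w" for w by (rule cy_antimono) (use n in simp)
    have "v \<notin> cy (2*n) z"
      using cy_disjoint_z[OF k(1,2)] k(3) sub[of z] by blast
    moreover have "v \<notin> cy (2*n) (zs l)" if "1 \<le> l" "l \<noteq> k" for l
      using cy_disjoint_zs[OF k(1,2) that(1)] that(2) k(3) sub[of "zs l"] by blast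
    ultimately show ?thesis
      using v[of n] unfolding E_def by (metis UN_E UnE atLeastAtMost_iff)
  qed
  then have "v = zs k"
    using k(3) zs[OF k(1)] C_subset by (intro eq_if_cy[of v "zs k" m]) (auto simp: mem_cyl)
  then show ?thesis using k by auto
next
  case False
  then have "v \<in> cy (2*m) z" for m using v[of m] unfolding E_def by auto
  then have "v = z"
    using z C_subset by (intro eq_if_cy[of v z 0]) (auto simp: mem_cyl)
  then show ?thesis by simp
qed

lemma layer_exists:
  assumes "y \<in> E m" "y \<notin> Z"
  obtains i where "i > m" "y \<in> B i"
proof -
  have ex: "\<exists>n. y \<notin> E n" using Inter_E_subset assms(2) by blast
  \<comment> \<open>The first set of the decreasing sequence that \<open>y\<close> has left. It is
    positive because \<open>y\<close> lies in \<open>E m\<close>, so its predecessor still contains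
    \<open>y\<close>.\<close>
  define i where "i = (LEAST n. y \<notin> E n)"
  have i: "y \<notin> E i" unfolding i_def by (rule LeastI_ex[OF ex])
  have "i > m"
  proof (rule ccontr)
    assume "\<not> i > m"
    then show False using E_antimono[of i m] assms(1) i by auto
  qed
  then obtain n where n: "i = Suc n" by (cases i) auto
  have "y \<in> E n" using not_less_Least[of n "\<lambda>n. y \<notin> E n"] n i_def by auto
  then show ?thesis using that[OF \<open>i > m\<close>] i B_eq[of n] n by auto
qed

lemma B_subset_E: "m < i \<Longrightarrow> B i \<subseteq> E m"
  using B_eq[of "i - 1"] E_antimono[of m "i - 1"] by force

lemma B_inter_E: "1 \<le> i \<Longrightarrow> B i \<inter> E i = {}"
  using B_eq[of "i - 1"] by auto

lemma B_disjoint: "1 \<le> i \<Longrightarrow> 1 \<le> j \<Longrightarrow> i \<noteq> j \<Longrightarrow> B i \<inter> B j = {}"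
  using B_subset_E[of i j] B_subset_E[of j i] B_inter_E[of i] B_inter_E[of j]
  by (cases "i < j") force+

lemma B_inter_Z: "1 \<le> i \<Longrightarrow> B i \<inter> Z = {}"
  using B_inter_E[of i] Z_subset_E[of i] by blast

lemma E_clopen: "openin T (E m)" "closedin T (E m)"
  unfolding E_def using cyl_clopen[OF homeo] by (auto intro!: closedin_Union)

lemma B_open: "1 \<le> i \<Longrightarrow> openin T (B i)"
  using B_eq[of "i - 1"] E_clopen by (auto intro: openin_diff)

section \<open>Approximation of \<open>Z\<close> by open sets\<close>

lemma E_base:
  assumes V: "openin T V" "Z \<subseteq> V"
  obtains m where "E m \<subseteq> V"
proof -
  obtain N where N: "cy (2*N) z \<subseteq> V" using cyl_base[OF homeo V(1)] V(2) by blast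
  have "\<exists>n. cy (2*n) (zs k) \<subseteq> V" if "1 \<le> k" for k
    using cyl_base[OF homeo V(1), of "zs k"] V(2) that by (metis atLeast_iff image_eqI insertI2 subsetD)
  then obtain g where g: "\<And>k. 1 \<le> k \<Longrightarrow> cy (2 * g k) (zs k) \<subseteq> V" by metis
  \<comment> \<open>\<open>N\<close> serves \<open>z\<close> and, through \<open>cy_zs\<close>,
    every \<open>zs k\<close> with \<open>k > N\<close>; the sum bounds each of the remaining
    finitely many \<open>g k\<close>. This is the compactness of \<open>Z\<close> made
    explicit.\<close>
  define m where "m = N + (\<Sum>k\<in>{1..N}. g k)"
  have "E m \<subseteq> V"
  proof
    fix v assume "v \<in> E m"
    then consider "v \<in> cy (2*m) z" | k where "1 \<le> k" "v \<in> cy (2*m) (zs k)"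
      unfolding E_def by auto
    then show "v \<in> V"
    proof cases
      case 1
      then show ?thesis using N cy_antimono[of "2*N" "2*m" z] unfolding m_def by auto
    next
      case 2
      show ?thesis
      proof (cases "k \<le> N")
        case True
        then have "g k \<le> (\<Sum>k\<in>{1..N}. g k)"
          using 2 by (intro member_le_sum) auto
        then show ?thesis
          using g[of k] 2 cy_antimono[of "2 * g k" "2*m" "zs k"] unfolding m_def by auto
      next
        case False
        then show ?thesis
          using N 2 cy_antimono[of "2*N" "2*m" "zs k"] cy_zs[of N k] unfolding m_def by auto
      qed
    qed
  qed
  then show ?thesis by (rule that)
qed

text \<open>The source of compactness of \<open>Z\<close>. It serves lower hemi-continuity at
  \<open>Z\<close>, and later the closedness of the image of \<open>Z\<close> under \<phi>.\<close>

lemma zs_tendsto: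
  assumes "openin T V" "z \<in> V"
  obtains N where "\<And>k. N < k \<Longrightarrow> zs k \<in> V"
proof -
  obtain N where N: "cy (2*N) z \<subseteq> V" using cyl_base[OF homeo assms] by blast
  have "zs k \<in> V" if "N < k" for k
  proof -
    have "zs k \<in> cy (2*N) (zs k)" using zs[of k] C_subset that by (auto simp: mem_cyl)
    then show ?thesis using cy_zs[OF that] N by blast
  qed
  then show ?thesis by (rule that)
qed

lemma inj_zs: "inj_on zs {1..}"
proof (rule inj_onI, rule ccontr)
  fix k l assume kl: "k \<in> {1..}" "l \<in> {1..}" "zs k = zs l" "k \<noteq> l"
  have "zs k \<in> cy (2*k) (zs k)" using zs[of k] kl C_subset by (auto simp: mem_cyl)
  then show False using cy_disjoint_zs[of k k l] kl by auto
qed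

section \<open>The glued partition and its hemi-continuity\<close>

lemma partition_\<P>: "1 \<le> i \<Longrightarrow> partition_on (C \<inter> B i) (\<P> i)"
  unfolding B_def by (rule \<P>_partition)

lemma partition_third: "partition_on C (third_partition \<P> z zs)"
proof (rule partition_onI)
  have sub: "M \<subseteq> C \<inter> B i" if "1 \<le> i" "M \<in> \<P> i" for M i
    using partition_onD1[OF partition_\<P>[OF that(1)]] that(2) by blast
  show "\<Union> (third_partition \<P> z zs) = C"
  proof
    show "\<Union> (third_partition \<P> z zs) \<subseteq> C"
      using sub Z_subset unfolding third_partition_def by auto
    show "C \<subseteq> \<Union> (third_partition \<P> z zs)"
    proof
      fix y assume y: "y \<in> C"
      show "y \<in> \<Union> (third_partition \<P> z zs)"
      proof (cases "y \<in> Z")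
        case True
        then show ?thesis unfolding third_partition_def by blast
      next
        case False
        then obtain i where "i > 0" "y \<in> B i"
          using layer_exists[of y 0] y C_subset E_0 by auto
        then obtain M where "M \<in> \<P> i" "y \<in> M"
          using partition_on_ex[OF partition_\<P>[of i], of y] y by auto
        then show ?thesis using \<open>i > 0\<close> unfolding third_partition_def by force
      qed
    qed
  qed
  show "{} \<notin> third_partition \<P> z zs"
    using partition_onD3[OF partition_\<P>] unfolding third_partition_def by auto
  have disj: "disjnt p q" if "1 \<le> i" "1 \<le> j" "p \<in> \<P> i" "q \<in> \<P> j" "p \<noteq> q" for p q i j
  proof (cases "i = j")
    case True
    then show ?thesis
      using partition_onD2[OF partition_\<P>[OF that(1)]] that unfolding disjoint_def disjnt_def by auto
  next
    case False
    then show ?thesis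
      using B_disjoint[OF that(1,2)] sub[OF that(1,3)] sub[OF that(2,4)] unfolding disjnt_def by blast
  qed
  have disjZ: "disjnt p Z" if "1 \<le> i" "p \<in> \<P> i" for p i
    using B_inter_Z[OF that(1)] sub[OF that] unfolding disjnt_def by blast
  show "disjnt p q" if p: "p \<in> third_partition \<P> z zs" and q: "q \<in> third_partition \<P> z zs"
    and ne: "p \<noteq> q" for p q
  proof -
    have "p = Z \<or> (\<exists>i\<ge>1. p \<in> \<P> i)" "q = Z \<or> (\<exists>i\<ge>1. q \<in> \<P> i)"
      using p q unfolding third_partition_def by auto
    then show ?thesis using disj disjZ ne disjnt_sym by metis
  qed
qed

lemma member_of_third_Z: "y \<in> Z \<Longrightarrow> member_of (third_partition \<P> z zs) y = Z"
  by (rule member_of_eq[OF partition_third]) (auto simp: third_partition_def)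

lemma member_of_third_B:
  assumes "1 \<le> i" "y \<in> C \<inter> B i"
  shows "member_of (third_partition \<P> z zs) y = member_of (\<P> i) y" "member_of (\<P> i) y \<in> \<P> i"
    "member_of (\<P> i) y \<subseteq> C \<inter> B i"
proof -
  obtain M where M: "M \<in> \<P> i" "y \<in> M"
    using partition_on_ex[OF partition_\<P>] assms by blast
  have "member_of (\<P> i) y = M" by (rule member_of_eq[OF partition_\<P>[OF assms(1)] M])
  moreover have "member_of (third_partition \<P> z zs) y = M"
    using M assms(1) by (intro member_of_eq[OF partition_third]) (auto simp: third_partition_def)
  ultimately show "member_of (third_partition \<P> z zs) y = member_of (\<P> i) y"
    "member_of (\<P> i) y \<in> \<P> i" "member_of (\<P> i) y \<subseteq> C \<inter> B i"
    using M partition_onD1[OF partition_\<P>[OF assms(1)]] by auto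
qed

text \<open>Layers are open, so at a point off \<open>Z\<close> the hemi-continuity assumed of
  \<open>\<P> i\<close> within its layer is enough.\<close>

lemma openin_layer:
  assumes "1 \<le> i" "openin (subtopology T (C \<inter> B i)) W"
  shows "openin (subtopology T C) W"
proof -
  obtain W' where "openin T W'" "W = W' \<inter> (C \<inter> B i)"
    using assms(2) unfolding openin_subtopology by blast
  then have "openin T (W' \<inter> B i)" "W = (W' \<inter> B i) \<inter> C"
    using B_open[OF assms(1)] by auto
  then show ?thesis unfolding openin_subtopology by blast
qed

lemma layerE:
  assumes "x \<in> C" "x \<notin> Z"
  obtains i where "1 \<le> i" "x \<in> C \<inter> B i"
  using layer_exists[of x 0] assms C_subset E_0 by (metis IntI One_nat_def Suc_leI subsetD)

lemma upper_third:
  "upper_hemicontinuous_partition (subtopology T C) (third_partition \<P> z zs)"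
  unfolding upper_hemicontinuous_partition_def upper_hemicontinuous_def
proof (intro ballI allI impI)
  fix x V
  assume x: "x \<in> topspace (subtopology T C)"
    and "openin (subtopology T C) V \<and> member_of (third_partition \<P> z zs) x \<subseteq> V"
  then have V: "openin (subtopology T C) V" "member_of (third_partition \<P> z zs) x \<subseteq> V"
    by blast+
  obtain V' where V': "openin T V'" "V = V' \<inter> C"
    using V(1) unfolding openin_subtopology by blast
  have xC: "x \<in> C" using x by simp
  show "\<exists>W. openin (subtopology T C) W \<and> x \<in> W \<and>
      (\<forall>y\<in>W. member_of (third_partition \<P> z zs) y \<subseteq> V)"
  proof (cases "x \<in> Z")
    case True
    then have ZV: "Z \<subseteq> V" using V(2) member_of_third_Z by metis
    then obtain m where m: "E m \<subseteq> V'"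
      using E_base[OF V'(1)] V'(2) by blast
    \<comment> \<open>A member through a point of \<open>E m\<close> off \<open>Z\<close> stays
      inside one layer \<open>B i\<close> with \<open>i > m\<close>, and that layer is contained in
      \<open>E m\<close>.\<close>
    have "member_of (third_partition \<P> z zs) y \<subseteq> V" if y: "y \<in> E m \<inter> C" for y
    proof (cases "y \<in> Z")
      case True
      then show ?thesis using ZV member_of_third_Z by metis
    next
      case False
      then obtain i where i: "i > m" "y \<in> B i"
        using layer_exists[of y m] y by blast
      have "member_of (third_partition \<P> z zs) y \<subseteq> C \<inter> B i"
        using member_of_third_B[of i y] i y by auto
      then show ?thesis using B_subset_E[OF i(1)] m V'(2) by blast
    qed
    moreover have "openin (subtopology T C) (E m \<inter> C)"
      using E_clopen(1) unfolding openin_subtopology by blast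
    ultimately show ?thesis using True Z_subset_E[of m] xC by blast
  next
    case False
    then obtain i where i: "1 \<le> i" "x \<in> C \<inter> B i" using layerE xC by blast
    have "openin (subtopology T (C \<inter> B i)) (V' \<inter> (C \<inter> B i))"
      using V'(1) unfolding openin_subtopology by blast
    moreover have "member_of (\<P> i) x \<subseteq> V' \<inter> (C \<inter> B i)"
      using member_of_third_B[OF i] V(2) V'(2) by auto
    moreover have "x \<in> topspace (subtopology T (C \<inter> B i))"
      using i(2) C_subset by auto
    ultimately obtain W where W: "openin (subtopology T (C \<inter> B i)) W" "x \<in> W"
      "\<forall>y\<in>W. member_of (\<P> i) y \<subseteq> V' \<inter> (C \<inter> B i)"
      using \<P>_upper[OF i(1), folded B_def]
      unfolding upper_hemicontinuous_partition_def upper_hemicontinuous_def by metis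
    have "W \<subseteq> C \<inter> B i" using openin_subset[OF W(1)] by auto
    then have "\<forall>y\<in>W. member_of (third_partition \<P> z zs) y \<subseteq> V"
      using W(3) member_of_third_B(1)[OF i(1)] V'(2) by blast
    then show ?thesis using openin_layer[OF i(1) W(1)] W(2) by blast
  qed
qed

lemma lower_third:
  "lower_hemicontinuous_partition (subtopology T C) (third_partition \<P> z zs)"
  unfolding lower_hemicontinuous_partition_def lower_hemicontinuous_def
proof (intro ballI allI impI)
  fix x V
  assume x: "x \<in> topspace (subtopology T C)"
    and "openin (subtopology T C) V \<and> member_of (third_partition \<P> z zs) x \<inter> V \<noteq> {}"
  then have V: "openin (subtopology T C) V" "member_of (third_partition \<P> z zs) x \<inter> V \<noteq> {}"
    by blast+
  obtain V' where V': "openin T V'" "V = V' \<inter> C"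
    using V(1) unfolding openin_subtopology by blast
  have xC: "x \<in> C" using x by simp
  show "\<exists>W. openin (subtopology T C) W \<and> x \<in> W \<and>
      (\<forall>y\<in>W. member_of (third_partition \<P> z zs) y \<inter> V \<noteq> {})"
  proof (cases "x \<in> Z")
    case True
    then have ZV: "Z \<inter> V \<noteq> {}" using V(2) member_of_third_Z by metis
    \<comment> \<open>An open set around \<open>z\<close> contains almost all \<open>zs l\<close>,
      so it is enough to approximate a single, fixed \<open>zs l\<close>.\<close>
    have "\<exists>l\<ge>1. zs l \<in> V'"
    proof (cases "z \<in> V'")
      case True
      then obtain N where "\<And>k. N < k \<Longrightarrow> zs k \<in> V'" using zs_tendsto[OF V'(1)] by blast
      then show ?thesis by (intro exI[of _ "Suc N"]) auto
    next
      case False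
      then show ?thesis using ZV V'(2) by auto
    qed
    then obtain l where l: "1 \<le> l" "zs l \<in> V'" by blast
    obtain N where N: "cy (2*N) (zs l) \<subseteq> V'" using cyl_base[OF homeo V'(1) l(2)] by blast
    \<comment> \<open>For \<open>i > l\<close> the set \<open>A_set\<close> with indices
      \<open>i\<close> and \<open>l\<close> falls under the first clause and lies in the cylinder of
      length \<open>2*i - 2\<close> about \<open>zs l\<close>; \<open>i > N\<close> makes that
      length at least \<open>2*N\<close>.\<close>
    define m where "m = max l N"
    have "member_of (third_partition \<P> z zs) y \<inter> V \<noteq> {}" if y: "y \<in> E m \<inter> C" for y
    proof (cases "y \<in> Z")
      case True
      then show ?thesis using ZV member_of_third_Z by metis
    next
      case False
      then obtain i where i: "i > m" "y \<in> B i"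
        using layer_exists[of y m] y by blast
      have y': "1 \<le> i" "y \<in> C \<inter> B i" using i y by auto
      have li: "l \<in> {1..i}" using i l unfolding m_def by auto
      obtain w where w: "w \<in> member_of (\<P> i) y" "w \<in> A_set (topspace T) \<pi> z zs i l"
        using \<P>_meets[OF y'(1) member_of_third_B(2)[OF y'] li] by blast
      have "w \<in> cy (2*i - 2) (zs l)" using w(2) i l unfolding A_set_def m_def by auto
      moreover have "2*N \<le> 2*i - 2" using i unfolding m_def by auto
      ultimately have "w \<in> V'"
        using cy_antimono[of "2*N" "2*i - 2" "zs l"] N by blast
      moreover have "w \<in> C" using w(1) member_of_third_B(3)[OF y'] by blast
      ultimately show ?thesis
        using w(1) member_of_third_B(1)[OF y'] V'(2) by auto
    qed
    moreover have "openin (subtopology T C) (E m \<inter> C)"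
      using E_clopen(1) unfolding openin_subtopology by blast
    ultimately show ?thesis using True Z_subset_E[of m] xC by blast
  next
    case False
    then obtain i where i: "1 \<le> i" "x \<in> C \<inter> B i" using layerE xC by blast
    have "openin (subtopology T (C \<inter> B i)) (V' \<inter> (C \<inter> B i))"
      using V'(1) unfolding openin_subtopology by blast
    moreover have "member_of (\<P> i) x \<inter> (V' \<inter> (C \<inter> B i)) \<noteq> {}"
      using member_of_third_B[OF i] V(2) V'(2) by auto
    moreover have "x \<in> topspace (subtopology T (C \<inter> B i))"
      using i(2) C_subset by auto
    ultimately obtain W where W: "openin (subtopology T (C \<inter> B i)) W" "x \<in> W"
      "\<forall>y\<in>W. member_of (\<P> i) y \<inter> (V' \<inter> (C \<inter> B i)) \<noteq> {}"
      using \<P>_lower[OF i(1), folded B_def]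
      unfolding lower_hemicontinuous_partition_def lower_hemicontinuous_def by metis
    have "W \<subseteq> C \<inter> B i" using openin_subset[OF W(1)] by auto
    then have "\<forall>y\<in>W. member_of (third_partition \<P> z zs) y \<inter> V \<noteq> {}"
      using W(3) member_of_third_B(1)[OF i(1)] V'(2) by blast
    then show ?thesis using openin_layer[OF i(1) W(1)] W(2) by blast
  qed
qed

end

subsection \<open>Information sets in the canonical structure\<close>

text \<open>Distinct maximal consistent sets are separated by a formula, and finitely many such
  formulas can be conjoined. In topological terms, finite sets are closed.\<close>

lemma \<Omega>_separate_finite:
  assumes "X \<noteq> {}" and "finite F" "F \<subseteq> \<Omega> X J" and v: "v \<in> \<Omega> X J" and "v \<notin> F"
  shows "\<exists>f\<in>v. \<forall>t\<in>F. f \<notin> t"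
  using assms(2,3,5)
proof (induction F rule: finite_induct)
  case empty
  \<comment> \<open>With nothing to separate, any formula of \<open>v\<close> will do; an atom or
    its negation is there.\<close>
  obtain x where "x \<in> X" using assms(1) by blast
  then have "Atom x \<in> lang X J" by (simp add: lang_def)
  then show ?case using v by (auto simp: \<Omega>_def complete_fms_def)
next
  case (insert t F)
  then obtain f where f: "f \<in> v" "\<forall>t\<in>F. f \<notin> t" by auto
  have "\<not> v \<subseteq> t" using \<Omega>_eqI[OF v, of t] insert.prems by auto
  then obtain g where g: "g \<in> v" "g \<notin> t" by blast
  have l: "f \<in> lang X J" "g \<in> lang X J" using f g \<Omega>_in_lang[OF v] by blast+
  have "Conj f g \<in> v" using \<Omega>_Conj[OF v l] f g by blast
  moreover have "Conj f g \<notin> u" if "u \<in> insert t F" for u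
  proof -
    have "u \<in> \<Omega> X J" using insert.prems that by blast
    from \<Omega>_Conj[OF this l] show ?thesis using that f g by blast
  qed
  ultimately show ?case by blast
qed

lemma \<beta>_\<phi>:
  assumes "kripke_structure K" "j \<in> persons K" "P \<in> part K j" "s \<in> P" "t \<in> P"
  shows "\<beta> j (\<phi> K s) = \<beta> j (\<phi> K t)"
  using \<alpha>_Know_iff[OF assms(1-3)] assms(4,5) unfolding \<beta>_def \<phi>_def by auto

text \<open>If \<open>f\<close> fails throughout \<open>P\<close>, then \<open>Neg f\<close> is
  known at \<open>s\<close>; equal knowledge and axiom T would put \<open>Neg f\<close> into
  \<open>v\<close> next to \<open>f\<close>.\<close>

lemma \<phi>_class_separated:
  assumes K: "kripke_structure K" "j \<in> persons K" "P \<in> part K j" "s \<in> P"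
    and v: "v \<in> \<Omega> (props K) (persons K)" and f: "f \<in> v" "\<And>u. u \<in> P \<Longrightarrow> f \<notin> \<phi> K u"
  shows "\<beta> j v \<noteq> \<beta> j (\<phi> K s)"
proof
  assume eq: "\<beta> j v = \<beta> j (\<phi> K s)"
  have l: "f \<in> lang (props K) (persons K)" using \<Omega>_in_lang[OF v f(1)] .
  then have "P \<subseteq> \<alpha> K (Neg f)"
    using f(2) kripke_member_subset[OF K(1-3)] unfolding \<phi>_def by auto
  then have "s \<in> \<alpha> K (Know j (Neg f))"
    using \<alpha>_Know_iff[OF K] by blast
  then have "Neg f \<in> \<beta> j (\<phi> K s)"
    using l K(2) unfolding \<beta>_def \<phi>_def by (simp add: lang_def)
  then have "Know j (Neg f) \<in> v" using eq unfolding \<beta>_def by blast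
  moreover have "Neg f \<in> lang (props K) (persons K)" using l by (simp add: lang_def)
  ultimately have "Neg f \<in> v" using \<Omega>_mp[OF v S5.axT[OF _ K(2)]] by blast
  then show False using \<Omega>_Neg[OF v l] f(1) by blast
qed

text \<open>A class of the canonical structure may exceed the image of an information set by limit
  points. \<open>sep\<close> says that the image is closed: every point outside it has a basic
  neighbourhood missing it.\<close>

lemma \<phi>_class:
  assumes K: "kripke_structure K" "j \<in> persons K" "P \<in> part K j" "s \<in> P"
    and sep: "\<And>v. v \<in> \<Omega> (props K) (persons K) \<Longrightarrow> v \<notin> \<phi> K ` P \<Longrightarrow>
      \<exists>f\<in>v. \<forall>u\<in>P. f \<notin> \<phi> K u"
  shows "{v \<in> \<Omega> (props K) (persons K). \<beta> j v = \<beta> j (\<phi> K s)} = \<phi> K ` P"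
proof (rule equalityI)
  show "{v \<in> \<Omega> (props K) (persons K). \<beta> j v = \<beta> j (\<phi> K s)} \<subseteq> \<phi> K ` P"
  proof (rule subsetI, rule ccontr)
    fix v assume v: "v \<in> {v \<in> \<Omega> (props K) (persons K). \<beta> j v = \<beta> j (\<phi> K s)}" "v \<notin> \<phi> K ` P"
    have v': "v \<in> \<Omega> (props K) (persons K)" "\<beta> j v = \<beta> j (\<phi> K s)"
      using v(1) by simp_all
    obtain f where f: "f \<in> v" "\<forall>u\<in>P. f \<notin> \<phi> K u"
      using sep[OF v'(1) v(2)] by blast
    have "\<beta> j v \<noteq> \<beta> j (\<phi> K s)"
      by (rule \<phi>_class_separated[OF K v'(1) f(1)]) (rule bspec[OF f(2)])
    then show False using v'(2) by (rule notE)
  qed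
  show "\<phi> K ` P \<subseteq> {v \<in> \<Omega> (props K) (persons K). \<beta> j v = \<beta> j (\<phi> K s)}"
  proof (rule subsetI)
    fix v assume "v \<in> \<phi> K ` P"
    then obtain t where t: "v = \<phi> K t" "t \<in> P" by (rule imageE)
    have "t \<in> states K" using kripke_member_subset[OF K(1-3)] t(2) by blast
    then show "v \<in> {v \<in> \<Omega> (props K) (persons K). \<beta> j v = \<beta> j (\<phi> K s)}"
      using \<phi>_in_\<Omega>[OF K(1)] \<beta>_\<phi>[OF K(1-3) t(2) K(4)] t(1) by auto
  qed
qed

lemma \<phi>_class_finite:
  assumes K: "kripke_structure K" "j \<in> persons K" "P \<in> part K j" "s \<in> P"
    and "props K \<noteq> {}" and "finite (\<phi> K ` P)"
  shows "{v \<in> \<Omega> (props K) (persons K). \<beta> j v = \<beta> j (\<phi> K s)} = \<phi> K ` P"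
proof (rule \<phi>_class[OF K])
  have "\<phi> K ` P \<subseteq> \<Omega> (props K) (persons K)"
    using \<phi>_in_\<Omega>[OF K(1)] kripke_member_subset[OF K(1-3)] by blast
  then show "\<exists>f\<in>v. \<forall>u\<in>P. f \<notin> \<phi> K u"
    if "v \<in> \<Omega> (props K) (persons K)" "v \<notin> \<phi> K ` P" for v
    using \<Omega>_separate_finite[OF assms(5,6) _ that] by simp
qed

lemma saturated_\<Omega>_class:
  assumes "saturated (\<Omega>_kripke X J) D" "j \<in> J" "w \<in> D" "v \<in> \<Omega> X J" "\<beta> j v = \<beta> j w"
  shows "v \<in> D"
proof -
  let ?Q = "{v \<in> \<Omega> X J. \<beta> j v = \<beta> j w}"
  have w: "w \<in> \<Omega> X J" using assms(1,3) by (auto simp: saturated_def \<Omega>_kripke_def)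
  then have Q: "?Q \<in> \<Q> X J j" and "?Q \<inter> D \<noteq> {}"
    using assms(3) by (auto simp: \<Q>_def)
  have "\<forall>P\<in>\<Q> X J j. P \<inter> D \<noteq> {} \<longrightarrow> P \<subseteq> D"
    using assms(1,2) unfolding saturated_def by (simp add: \<Omega>_kripke_def)
  from bspec[OF this Q] have "?Q \<subseteq> D"
    using \<open>?Q \<inter> D \<noteq> {}\<close> by (rule HOL.mp)
  then show ?thesis using assms(4,5) by blast
qed

lemma saturated_\<Omega>I:
  assumes "D \<noteq> {}" "D \<subseteq> \<Omega> X J"
    and cl: "\<And>j w v. j \<in> J \<Longrightarrow> w \<in> D \<Longrightarrow> v \<in> \<Omega> X J \<Longrightarrow> \<beta> j v = \<beta> j w \<Longrightarrow> v \<in> D"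
  shows "saturated (\<Omega>_kripke X J) D"
proof -
  have "P \<subseteq> D" if j: "j \<in> J" and P: "P \<in> \<Q> X J j" "P \<inter> D \<noteq> {}" for j P
  proof -
    obtain u where u: "P = {v \<in> \<Omega> X J. \<beta> j v = \<beta> j u}"
      using P(1) unfolding \<Q>_def by blast
    obtain w where "w \<in> D" "w \<in> P" using P(2) by blast
    then have "w \<in> D" "\<beta> j w = \<beta> j u" unfolding u by blast+
    then show ?thesis using cl[OF j \<open>w \<in> D\<close>] unfolding u by auto
  qed
  then show ?thesis using assms(1,2) by (simp add: saturated_def \<Omega>_kripke_def)
qed

lemma restrict_\<Q>:
  assumes "saturated (\<Omega>_kripke X J) C" "j \<in> J"
  shows "restrict_partition (\<Q> X J j) C = (\<lambda>w. {v \<in> \<Omega> X J. \<beta> j v = \<beta> j w}) ` C"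
proof -
  have C: "C \<subseteq> \<Omega> X J" using assms(1) by (auto simp: saturated_def \<Omega>_kripke_def)
  have sub: "{v \<in> \<Omega> X J. \<beta> j v = \<beta> j w} \<subseteq> C" if "w \<in> C" for w
    using saturated_\<Omega>_class[OF assms that] by blast
  show ?thesis
  proof
    show "restrict_partition (\<Q> X J j) C \<subseteq> (\<lambda>w. {v \<in> \<Omega> X J. \<beta> j v = \<beta> j w}) ` C"
    proof
      fix P assume "P \<in> restrict_partition (\<Q> X J j) C"
      then obtain u where P: "P = {v \<in> \<Omega> X J. \<beta> j v = \<beta> j u} \<inter> C" "P \<noteq> {}"
        unfolding restrict_partition_def \<Q>_def by blast
      then obtain w where w: "w \<in> C" "\<beta> j w = \<beta> j u" by blast
      then have "P = {v \<in> \<Omega> X J. \<beta> j v = \<beta> j w}" using P(1) sub[OF w(1)] by auto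
      then show "P \<in> (\<lambda>w. {v \<in> \<Omega> X J. \<beta> j v = \<beta> j w}) ` C" using w(1) by blast
    qed
    show "(\<lambda>w. {v \<in> \<Omega> X J. \<beta> j v = \<beta> j w}) ` C \<subseteq> restrict_partition (\<Q> X J j) C"
    proof
      fix P assume "P \<in> (\<lambda>w. {v \<in> \<Omega> X J. \<beta> j v = \<beta> j w}) ` C"
      then obtain w where w: "w \<in> C" "P = {v \<in> \<Omega> X J. \<beta> j v = \<beta> j w}" by blast
      then have "P \<in> \<Q> X J j" "P = P \<inter> C" "P \<inter> C \<noteq> {}"
        using C sub[OF w(1)] unfolding \<Q>_def by blast+
      then show "P \<in> restrict_partition (\<Q> X J j) C"
        unfolding restrict_partition_def by blast
    qed
  qed
qed

lemma partition_on_restrict_\<Q>: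
  assumes "C \<subseteq> \<Omega> X J"
  shows "partition_on C (restrict_partition (\<Q> X J j) C)"
proof -
  have "restrict_partition (\<Q> X J j) C = (\<inter>) C ` \<Q> X J j - {{}}"
    unfolding restrict_partition_def by auto
  moreover have "C = C \<inter> \<Omega> X J" using assms by auto
  ultimately show ?thesis using partition_on_restrict[OF partition_on_\<Q>[of X J j], of C] by simp
qed

text \<open>\<open>K\<close> may have persons outside \<open>J\<close>, but formulas over
  \<open>J\<close> see only the partitions of \<open>J\<close>. For \<open>Know\<close>, saturation
  keeps whole classes inside \<open>C\<close>, so the quantifier over \<Omega> in
  \<open>\<Omega>_Know_iff\<close> never leaves \<open>C\<close>.\<close>

lemma truth_lemma:
  assumes C: "saturated (\<Omega>_kripke X J) C"
    and K: "states K = C" "\<And>j. j \<in> J \<Longrightarrow> part K j = restrict_partition (\<Q> X J j) C"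
      "\<And>w x. w \<in> C \<Longrightarrow> val K w x \<longleftrightarrow> Atom x \<in> w"
    and "f \<in> lang X J"
  shows "\<alpha> K f = {w \<in> C. f \<in> w}"
  using assms(5)
proof (induction f)
  case (Atom x)
  then show ?case using K by auto
next
  case (Neg f)
  have C': "C \<subseteq> \<Omega> X J" using C by (auto simp: saturated_def \<Omega>_kripke_def)
  have "f \<in> lang X J" using Neg by (simp add: lang_def)
  moreover have "Neg f \<in> w \<longleftrightarrow> f \<notin> w" if "w \<in> C" for w
    using \<Omega>_Neg[of w X J f] C' that calculation by blast
  ultimately show ?case using Neg.IH K(1) by auto
next
  case (Conj f g)
  have C': "C \<subseteq> \<Omega> X J" using C by (auto simp: saturated_def \<Omega>_kripke_def)
  have "f \<in> lang X J" "g \<in> lang X J" using Conj by (simp_all add: lang_def)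
  moreover have "Conj f g \<in> w \<longleftrightarrow> f \<in> w \<and> g \<in> w" if "w \<in> C" for w
    using \<Omega>_Conj[of w X J f g] C' that calculation by blast
  ultimately show ?case using Conj.IH by auto
next
  case (Know j f)
  have C': "C \<subseteq> \<Omega> X J" using C by (auto simp: saturated_def \<Omega>_kripke_def)
  have j: "j \<in> J" and f: "f \<in> lang X J" using Know by (simp_all add: lang_def)
  have IH: "\<alpha> K f = {w \<in> C. f \<in> w}" by (rule Know.IH[OF f])
  have "(\<forall>P\<in>part K j. w \<in> P \<longrightarrow> P \<subseteq> \<alpha> K f) \<longleftrightarrow> Know j f \<in> w" if w: "w \<in> C" for w
  proof -
    let ?P = "{v \<in> \<Omega> X J. \<beta> j v = \<beta> j w}"
    have "part K j = (\<lambda>w. {v \<in> \<Omega> X J. \<beta> j v = \<beta> j w}) ` C"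
      using K(2)[OF j] restrict_\<Q>[OF C j] by simp
    then have P: "?P \<in> part K j" "w \<in> ?P" using w C' by auto
    have "partition_on C (part K j)"
      using partition_on_restrict_\<Q>[OF C', of j] K(2)[OF j] by simp
    then have uniq: "Q = ?P" if "Q \<in> part K j" "w \<in> Q" for Q
      by (rule partition_on_eqI[OF _ that(1) P(1) that(2) P(2)])
    have "(\<forall>P\<in>part K j. w \<in> P \<longrightarrow> P \<subseteq> \<alpha> K f) \<longleftrightarrow> ?P \<subseteq> \<alpha> K f"
    proof (intro iffI ballI impI)
      assume "\<forall>P\<in>part K j. w \<in> P \<longrightarrow> P \<subseteq> \<alpha> K f"
      from bspec[OF this P(1)] P(2) show "?P \<subseteq> \<alpha> K f" by (rule HOL.mp)
    next
      fix Q assume sub: "?P \<subseteq> \<alpha> K f" and Q: "Q \<in> part K j" "w \<in> Q"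
      show "Q \<subseteq> \<alpha> K f" unfolding uniq[OF Q] by (rule sub)
    qed
    also have "\<dots> \<longleftrightarrow> (\<forall>v\<in>\<Omega> X J. \<beta> j v = \<beta> j w \<longrightarrow> f \<in> v)"
      unfolding IH using saturated_\<Omega>_class[OF C j w] by blast
    also have "\<dots> \<longleftrightarrow> Know j f \<in> w"
      using \<Omega>_Know_iff[OF _ j f] C' w by blast
    finally show ?thesis .
  qed
  then show ?case using K(1) by auto
qed

subsection \<open>The formula topology\<close>

lemma topspace_\<Omega>_top:
  assumes "X \<noteq> {}" shows "topspace (\<Omega>_top X J) = \<Omega> X J"
proof -
  have "\<exists>f\<in>lang X J. f \<in> w" if "w \<in> \<Omega> X J" for w
    using \<Omega>_separate_finite[OF assms, of "{}" J w] \<Omega>_in_lang[OF that] that by auto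
  then show ?thesis unfolding \<Omega>_top_def topology_generated_by_topspace by auto
qed

lemma openin_\<Omega>_formula: "f \<in> lang X J \<Longrightarrow> openin (\<Omega>_top X J) {w \<in> \<Omega> X J. f \<in> w}"
  unfolding \<Omega>_top_def by (auto intro: topology_generated_by_Basis)

lemma \<Omega>_top_base:
  assumes "openin (\<Omega>_top X J) V" "w \<in> V"
  shows "\<exists>f\<in>lang X J. f \<in> w \<and> {u \<in> \<Omega> X J. f \<in> u} \<subseteq> V"
proof -
  have "generate_topology_on ((\<lambda>f. {w \<in> \<Omega> X J. f \<in> w}) ` lang X J) V"
    using assms(1) unfolding \<Omega>_top_def openin_topology_generated_by_iff .
  then show ?thesis using assms(2)
  proof (induction arbitrary: w)
    case Empty
    then show ?case by simp
  next
    case (Int a b)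
    obtain f where f: "f \<in> lang X J" "f \<in> w" "{u \<in> \<Omega> X J. f \<in> u} \<subseteq> a"
      using Int.IH(1)[of w] Int.prems by blast
    obtain g where g: "g \<in> lang X J" "g \<in> w" "{u \<in> \<Omega> X J. g \<in> u} \<subseteq> b"
      using Int.IH(2)[of w] Int.prems by blast
    have "w \<in> \<Omega> X J"
    proof -
      have "openin (\<Omega>_top X J) a"
        using Int.hyps unfolding \<Omega>_top_def openin_topology_generated_by_iff by blast
      then have "w \<in> topspace (\<Omega>_top X J)" using Int.prems openin_subset by blast
      then show ?thesis unfolding \<Omega>_top_def topology_generated_by_topspace by auto
    qed
    then have "Conj f g \<in> w" using \<Omega>_Conj f g by blast
    moreover have "{u \<in> \<Omega> X J. Conj f g \<in> u} \<subseteq> a \<inter> b"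
      using \<Omega>_Conj[OF _ f(1) g(1)] f(3) g(3) by auto
    moreover have "Conj f g \<in> lang X J" using f(1) g(1) by (simp add: lang_def)
    ultimately show ?case by blast
  next
    case (UN K)
    then obtain k where k: "k \<in> K" "w \<in> k" by blast
    then obtain f where "f \<in> lang X J" "f \<in> w" "{u \<in> \<Omega> X J. f \<in> u} \<subseteq> k"
      using UN.IH[of k w] by blast
    then show ?case using k(1) by blast
  next
    case (Basis s)
    then show ?case by auto
  qed
qed

text \<open>A finite disjunction of basic neighbourhoods, written with \<open>Neg\<close> and
  \<open>Conj\<close>; the empty disjunction is a contradiction. Finite fanout enters upper
  hemi-continuity through this single formula.\<close>

lemma \<Omega>_top_finite_base:
  assumes "X \<noteq> {}" "openin (\<Omega>_top X J) V" "finite F" "F \<subseteq> V"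
  shows "\<exists>f\<in>lang X J. (\<forall>v\<in>F. f \<in> v) \<and> {u \<in> \<Omega> X J. f \<in> u} \<subseteq> V"
  using assms(3,4)
proof (induction F rule: finite_induct)
  case empty
  obtain x where "x \<in> X" using assms(1) by blast
  then have l: "Atom x \<in> lang X J" "Neg (Atom x) \<in> lang X J" by (simp_all add: lang_def)
  have "Conj (Atom x) (Neg (Atom x)) \<notin> u" if "u \<in> \<Omega> X J" for u
    using \<Omega>_Conj[OF that l] \<Omega>_Neg[OF that l(1)] by blast
  moreover have "Conj (Atom x) (Neg (Atom x)) \<in> lang X J" using l by (simp add: lang_def)
  ultimately show ?case by blast
next
  case (insert t F)
  then obtain f where f: "f \<in> lang X J" "\<forall>v\<in>F. f \<in> v" "{u \<in> \<Omega> X J. f \<in> u} \<subseteq> V" by blast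
  obtain g where g: "g \<in> lang X J" "g \<in> t" "{u \<in> \<Omega> X J. g \<in> u} \<subseteq> V"
    using \<Omega>_top_base[OF assms(2), of t] insert.prems by blast
  let ?h = "Neg (Conj (Neg f) (Neg g))"
  have l: "Neg f \<in> lang X J" "Neg g \<in> lang X J" "Conj (Neg f) (Neg g) \<in> lang X J" "?h \<in> lang X J"
    using f(1) g(1) by (simp_all add: lang_def)
  have h: "?h \<in> u \<longleftrightarrow> f \<in> u \<or> g \<in> u" if u: "u \<in> \<Omega> X J" for u
    unfolding \<Omega>_Neg[OF u l(3)] \<Omega>_Conj[OF u l(1,2)] \<Omega>_Neg[OF u f(1)] \<Omega>_Neg[OF u g(1)] by blast
  have "insert t F \<subseteq> \<Omega> X J"
    using insert.prems openin_subset[OF assms(2)] topspace_\<Omega>_top[OF assms(1)] by blast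
  then have "\<forall>v\<in>insert t F. ?h \<in> v" using h f(2) g(2) by blast
  moreover have "{u \<in> \<Omega> X J. ?h \<in> u} \<subseteq> V" using h f(3) g(3) by blast
  ultimately show ?case using l(4) by blast
qed

lemma member_of_restrict_\<Q>:
  assumes C: "saturated (\<Omega>_kripke X J) C" "j \<in> J" and w: "w \<in> C"
  shows "member_of (restrict_partition (\<Q> X J j) C) w = {v \<in> \<Omega> X J. \<beta> j v = \<beta> j w}"
proof (rule member_of_eq[OF partition_on_restrict_\<Q>])
  show C': "C \<subseteq> \<Omega> X J" using C by (auto simp: saturated_def \<Omega>_kripke_def)
  show "{v \<in> \<Omega> X J. \<beta> j v = \<beta> j w} \<in> restrict_partition (\<Q> X J j) C"
    unfolding restrict_\<Q>[OF C] using w by blast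
  show "w \<in> {v \<in> \<Omega> X J. \<beta> j v = \<beta> j w}" using w C' by blast
qed

lemma hemicontinuous_restrict_\<Q>:
  assumes X: "X \<noteq> {}" and C: "saturated (\<Omega>_kripke X J) C" and j: "j \<in> J"
    and fin: "\<And>w. w \<in> C \<Longrightarrow> finite {v \<in> \<Omega> X J. \<beta> j v = \<beta> j w}"
  shows "upper_hemicontinuous_partition (subtopology (\<Omega>_top X J) C) (restrict_partition (\<Q> X J j) C)"
    and "lower_hemicontinuous_partition (subtopology (\<Omega>_top X J) C) (restrict_partition (\<Q> X J j) C)"
proof -
  let ?T = "subtopology (\<Omega>_top X J) C" and ?m = "member_of (restrict_partition (\<Q> X J j) C)"
  have C': "C \<subseteq> \<Omega> X J" using C by (auto simp: saturated_def \<Omega>_kripke_def)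
  have m: "?m w = {v \<in> \<Omega> X J. \<beta> j v = \<beta> j w}" if "w \<in> C" for w
    by (rule member_of_restrict_\<Q>[OF C j that])
  have top: "openin ?T ({w \<in> \<Omega> X J. f \<in> w} \<inter> C)" if "f \<in> lang X J" for f
    using openin_\<Omega>_formula[OF that] unfolding openin_subtopology by blast
  show "upper_hemicontinuous_partition ?T (restrict_partition (\<Q> X J j) C)"
    unfolding upper_hemicontinuous_partition_def upper_hemicontinuous_def
  proof (intro ballI allI impI)
    fix w V assume w: "w \<in> topspace ?T" and V: "openin ?T V \<and> ?m w \<subseteq> V"
    obtain V' where V': "openin (\<Omega>_top X J) V'" "V = V' \<inter> C"
      using V unfolding openin_subtopology by blast
    have wC: "w \<in> C" using w by simp
    have "{v \<in> \<Omega> X J. \<beta> j v = \<beta> j w} \<subseteq> V'" using V V'(2) m[OF wC] by blast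
    then obtain f where f: "f \<in> lang X J" "\<forall>v\<in>{v \<in> \<Omega> X J. \<beta> j v = \<beta> j w}. f \<in> v"
      "{u \<in> \<Omega> X J. f \<in> u} \<subseteq> V'"
      using \<Omega>_top_finite_base[OF X V'(1) fin[OF wC]] by blast
    \<comment> \<open>The points where \<open>j\<close> knows \<open>f\<close> form the
      neighbourhood sought: their classes lie in the set defined by \<open>f\<close>.\<close>
    have K: "Know j f \<in> lang X J" using f(1) j by (simp add: lang_def)
    have "w \<in> {w \<in> \<Omega> X J. Know j f \<in> w} \<inter> C"
      using \<Omega>_Know_iff[of w X J j f] wC C' j f(1,2) by blast
    moreover have "?m y \<subseteq> V" if y: "y \<in> {w \<in> \<Omega> X J. Know j f \<in> w} \<inter> C" for y
    proof
      fix v assume "v \<in> ?m y"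
      then have v: "v \<in> \<Omega> X J" "\<beta> j v = \<beta> j y" using m[of y] y by blast+
      have "f \<in> v" using \<Omega>_Know_iff[of y X J j f] y v j f(1) by blast
      then show "v \<in> V" using v f(3) V'(2) saturated_\<Omega>_class[OF C j, of y v] y by blast
    qed
    ultimately show "\<exists>W. openin ?T W \<and> w \<in> W \<and> (\<forall>y\<in>W. ?m y \<subseteq> V)"
      using top[OF K] by blast
  qed
  show "lower_hemicontinuous_partition ?T (restrict_partition (\<Q> X J j) C)"
    unfolding lower_hemicontinuous_partition_def lower_hemicontinuous_def
  proof (intro ballI allI impI)
    fix w V assume w: "w \<in> topspace ?T" and V: "openin ?T V \<and> ?m w \<inter> V \<noteq> {}"
    obtain V' where V': "openin (\<Omega>_top X J) V'" "V = V' \<inter> C"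
      using V unfolding openin_subtopology by blast
    have wC: "w \<in> C" using w by simp
    obtain v where v: "v \<in> \<Omega> X J" "\<beta> j v = \<beta> j w" "v \<in> V'"
      using V V'(2) m[OF wC] by blast
    obtain f where f: "f \<in> lang X J" "f \<in> v" "{u \<in> \<Omega> X J. f \<in> u} \<subseteq> V'"
      using \<Omega>_top_base[OF V'(1) v(3)] by blast
    \<comment> \<open>\<open>Neg ?k\<close> says that \<open>j\<close> considers \<open>f\<close>
      possible, that is, some point of the class satisfies \<open>f\<close>. The points containing
      it form the neighbourhood sought.\<close>
    let ?k = "Know j (Neg f)"
    have l: "Neg f \<in> lang X J" "?k \<in> lang X J" "Neg ?k \<in> lang X J"
      using f(1) j by (simp_all add: lang_def)
    have k: "Neg ?k \<in> u \<longleftrightarrow> (\<exists>v\<in>\<Omega> X J. \<beta> j v = \<beta> j u \<and> f \<in> v)" if u: "u \<in> \<Omega> X J" for u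
      unfolding \<Omega>_Neg[OF u l(2)] \<Omega>_Know_iff[OF u j l(1)] using \<Omega>_Neg[OF _ f(1)] by blast
    have "w \<in> {w \<in> \<Omega> X J. Neg ?k \<in> w} \<inter> C"
      using k[of w] wC C' v f(2) by blast
    moreover have "?m y \<inter> V \<noteq> {}" if y: "y \<in> {w \<in> \<Omega> X J. Neg ?k \<in> w} \<inter> C" for y
    proof -
      obtain u where u: "u \<in> \<Omega> X J" "\<beta> j u = \<beta> j y" "f \<in> u" using k[of y] y by blast
      have "u \<in> V" using u f(3) V'(2) saturated_\<Omega>_class[OF C j, of y u] y by blast
      moreover have "u \<in> ?m y" using u m[of y] y by blast
      ultimately show ?thesis by blast
    qed
    ultimately show "\<exists>W. openin ?T W \<and> w \<in> W \<and> (\<forall>y\<in>W. ?m y \<inter> V \<noteq> {})"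
      using top[OF l(3)] by blast
  qed
qed

text \<open>Hemi-continuity is what \<open>Know\<close> needs: its extent consists of the points
  whose information set lies inside an open set, open by the upper half, and the complement of those
  whose information set meets an open set, open by the lower half.\<close>

lemma \<alpha>_clopen:
  assumes K: "kripke_structure K" and T: "topspace T = states K"
    and upper: "\<And>j. j \<in> persons K \<Longrightarrow> upper_hemicontinuous_partition T (part K j)"
    and lower: "\<And>j. j \<in> persons K \<Longrightarrow> lower_hemicontinuous_partition T (part K j)"
    and atoms: "\<And>x. x \<in> props K \<Longrightarrow> openin T (\<alpha> K (Atom x)) \<and> closedin T (\<alpha> K (Atom x))"
    and "f \<in> lang (props K) (persons K)"
  shows "openin T (\<alpha> K f) \<and> closedin T (\<alpha> K f)"
  using assms(6)
proof (induction f)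
  case (Atom x)
  then show ?case using atoms by (simp add: lang_def)
next
  case (Neg f)
  then have "openin T (\<alpha> K f) \<and> closedin T (\<alpha> K f)" by (simp add: lang_def)
  then show ?case using T[symmetric] by auto
next
  case (Conj f g)
  then show ?case by (auto simp: lang_def)
next
  case (Know j f)
  then have j: "j \<in> persons K" and IH: "openin T (\<alpha> K f)" "closedin T (\<alpha> K f)"
    by (simp_all add: lang_def)
  have part: "partition_on (states K) (part K j)" using K j unfolding kripke_structure_def by blast
  have m: "s \<in> \<alpha> K (Know j f) \<longleftrightarrow> member_of (part K j) s \<subseteq> \<alpha> K f" if s: "s \<in> states K" for s
  proof -
    obtain P where P: "P \<in> part K j" "s \<in> P" using partition_on_ex[OF part s] by blast
    show ?thesis using \<alpha>_Know_iff[OF K j P] member_of_eq[OF part P] by simp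
  qed
  have "openin T (\<alpha> K (Know j f))"
  proof (subst openin_subopen, rule ballI)
    fix s assume s: "s \<in> \<alpha> K (Know j f)"
    then have sK: "s \<in> states K" using \<alpha>_subset_states[of K "Know j f"] by blast
    obtain W where W: "openin T W" "s \<in> W" "\<forall>y\<in>W. member_of (part K j) y \<subseteq> \<alpha> K f"
      using upper[OF j] IH(1) m[OF sK] s sK T
      unfolding upper_hemicontinuous_partition_def upper_hemicontinuous_def by metis
    have "W \<subseteq> states K" using openin_subset[OF W(1)] T by simp
    then have "W \<subseteq> \<alpha> K (Know j f)" using W(3) m by blast
    then show "\<exists>W. openin T W \<and> s \<in> W \<and> W \<subseteq> \<alpha> K (Know j f)" using W(1,2) by blast
  qed
  moreover have "openin T (states K - \<alpha> K (Know j f))"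
  proof (subst openin_subopen, rule ballI)
    fix s assume s: "s \<in> states K - \<alpha> K (Know j f)"
    have V: "openin T (states K - \<alpha> K f)" using IH(2) T openin_diff[OF openin_topspace] by metis
    have member_sub: "member_of (part K j) y \<subseteq> states K" if y: "y \<in> states K" for y
    proof -
      obtain P where P: "P \<in> part K j" "y \<in> P" using partition_on_ex[OF part y] by blast
      then show ?thesis using member_of_eq[OF part P] kripke_member_subset[OF K j] by simp
    qed
    have "member_of (part K j) s \<inter> (states K - \<alpha> K f) \<noteq> {}"
      using s m[of s] member_sub[of s] by blast
    then obtain W where W: "openin T W" "s \<in> W"
      "\<forall>y\<in>W. member_of (part K j) y \<inter> (states K - \<alpha> K f) \<noteq> {}"
      using lower[OF j] V s T
      unfolding lower_hemicontinuous_partition_def lower_hemicontinuous_def by (metis DiffD1)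
    have "W \<subseteq> states K" using openin_subset[OF W(1)] T by simp
    then have "W \<subseteq> states K - \<alpha> K (Know j f)" using W(3) m by blast
    then show "\<exists>W. openin T W \<and> s \<in> W \<and> W \<subseteq> states K - \<alpha> K (Know j f)" using W(1,2) by blast
  qed
  ultimately show ?case
    using T \<alpha>_subset_states[of K "Know j f"] unfolding closedin_def by simp
qed

subsection \<open>Adding persons to a cell\<close>

lemma lang_mono:
  assumes "J \<subseteq> J'" shows "lang X J \<subseteq> lang X J'"
proof -
  have "in_lang X J f \<Longrightarrow> in_lang X J' f" for f
    using assms by (induction f) auto
  then show ?thesis by (auto simp: lang_def)
qed

text \<open>\<open>K\<close> keeps the information of the persons in \<open>J\<close> and leaves
  that of all others free, so what follows from minimality of \<open>C\<close> and from finite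
  classes holds whatever the added persons know.\<close>

locale cell_extension =
  fixes X :: "'x set" and J :: "'j set" and C :: "('x, 'j) fm set set"
    and K :: "(('x, 'j) fm set, 'j, 'x) kripke"
  assumes X_nonempty: "X \<noteq> {}"
    and cell: "is_cell (\<Omega>_kripke X J) C"
    and finite_class: "j \<in> J \<Longrightarrow> w \<in> C \<Longrightarrow> finite {v \<in> \<Omega> X J. \<beta> j v = \<beta> j w}"
    and K: "kripke_structure K"
    and states_K: "states K = C"
    and props_K: "props K = X"
    and persons_K: "J \<subseteq> persons K"
    and part_K: "j \<in> J \<Longrightarrow> part K j = restrict_partition (\<Q> X J j) C"
    and val_K: "w \<in> C \<Longrightarrow> val K w x \<longleftrightarrow> Atom x \<in> w"
begin

lemma saturated_C: "saturated (\<Omega>_kripke X J) C"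
  using cell unfolding is_cell_def by blast

lemma C_subset_\<Omega>: "C \<subseteq> \<Omega> X J"
  using saturated_C by (simp add: saturated_def \<Omega>_kripke_def)

lemma \<phi>_K_in_\<Omega>: "w \<in> C \<Longrightarrow> \<phi> K w \<in> \<Omega> X (persons K)"
  using \<phi>_in_\<Omega>[OF K] states_K props_K by simp

lemma class_in_part:
  assumes "j \<in> J" "w \<in> C"
  shows "{v \<in> \<Omega> X J. \<beta> j v = \<beta> j w} \<in> part K j" "w \<in> {v \<in> \<Omega> X J. \<beta> j v = \<beta> j w}"
  using restrict_\<Q>[OF saturated_C assms(1)] part_K[OF assms(1)] assms(2) C_subset_\<Omega> by auto

lemma \<phi>_K_restrict:
  assumes w: "w \<in> C" and f: "f \<in> lang X J" shows "f \<in> \<phi> K w \<longleftrightarrow> f \<in> w"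
proof -
  have "\<alpha> K f = {w \<in> C. f \<in> w}"
    by (rule truth_lemma[OF saturated_C states_K part_K val_K f])
  moreover have "f \<in> lang (props K) (persons K)"
    using lang_mono[OF persons_K] f props_K by blast
  ultimately show ?thesis using w unfolding \<phi>_def by blast
qed

lemma inj_\<phi>_K: "inj_on (\<phi> K) C"
proof (rule inj_onI)
  fix w v assume wv: "w \<in> C" "v \<in> C" "\<phi> K w = \<phi> K v"
  have \<Omega>: "w \<in> \<Omega> X J" "v \<in> \<Omega> X J" using wv C_subset_\<Omega> by blast+
  have "w \<subseteq> v"
  proof
    fix f assume f: "f \<in> w"
    then have "f \<in> lang X J" by (rule \<Omega>_in_lang[OF \<Omega>(1)])
    then show "f \<in> v" using \<phi>_K_restrict wv f by blast
  qed
  then show "w = v" by (rule \<Omega>_eqI[OF \<Omega>])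
qed

text \<open>Common core of minimality and surjectivity: \<open>D\<close> is a saturated subset of
  the image in one case and the image of a competing structure in the other.\<close>

lemma pullback_eq_C:
  assumes "w\<^sub>0 \<in> C" "\<phi> K w\<^sub>0 \<in> D"
    and step: "\<And>j w v. j \<in> J \<Longrightarrow> w \<in> C \<Longrightarrow> v \<in> C \<Longrightarrow> \<beta> j v = \<beta> j w \<Longrightarrow>
      \<phi> K w \<in> D \<Longrightarrow> \<phi> K v \<in> D"
  shows "\<phi> K ` C \<subseteq> D"
proof -
  let ?C = "{w \<in> C. \<phi> K w \<in> D}"
  have "saturated (\<Omega>_kripke X J) ?C"
  proof (rule saturated_\<Omega>I)
    show "?C \<noteq> {}" using assms(1,2) by blast
    show "?C \<subseteq> \<Omega> X J" using C_subset_\<Omega> by blast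
    fix j w v assume j: "j \<in> J" and w: "w \<in> ?C" and v: "v \<in> \<Omega> X J" "\<beta> j v = \<beta> j w"
    have wC: "w \<in> C" "\<phi> K w \<in> D" using w by simp_all
    have "v \<in> C" by (rule saturated_\<Omega>_class[OF saturated_C j wC(1) v])
    then show "v \<in> ?C" using step[OF j wC(1) _ v(2) wC(2)] by simp
  qed
  moreover have "?C \<subseteq> C" by blast
  ultimately have "?C = C" using cell unfolding is_cell_def by meson
  then show ?thesis by blast
qed

lemma is_cell_image:
  assumes "\<And>j P w. j \<in> persons K \<Longrightarrow> P \<in> part K j \<Longrightarrow> w \<in> P \<Longrightarrow>
    {v \<in> \<Omega> X (persons K). \<beta> j v = \<beta> j (\<phi> K w)} = \<phi> K ` P"
  shows "is_cell (\<Omega>_kripke X (persons K)) (\<phi> K ` C)"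
  unfolding is_cell_def
proof (intro conjI allI impI)
  show "saturated (\<Omega>_kripke X (persons K)) (\<phi> K ` C)"
  proof (rule saturated_\<Omega>I)
    show "\<phi> K ` C \<noteq> {}" using saturated_C unfolding saturated_def by blast
    show "\<phi> K ` C \<subseteq> \<Omega> X (persons K)" using \<phi>_K_in_\<Omega> by blast
    fix j w' v assume j: "j \<in> persons K" and w': "w' \<in> \<phi> K ` C"
      and v: "v \<in> \<Omega> X (persons K)" "\<beta> j v = \<beta> j w'"
    obtain w where w: "w' = \<phi> K w" "w \<in> C" using w' by (rule imageE)
    obtain P where P: "P \<in> part K j" "w \<in> P" "P \<subseteq> states K"
      using kripke_memberE[OF K j] w(2) states_K by metis
    have "v \<in> {v \<in> \<Omega> X (persons K). \<beta> j v = \<beta> j (\<phi> K w)}" using v w(1) by simp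
    then have "v \<in> \<phi> K ` P" unfolding assms[OF j P(1,2)] .
    then show "v \<in> \<phi> K ` C" using P(3) states_K by blast
  qed
next
  fix D assume D: "saturated (\<Omega>_kripke X (persons K)) D \<and> D \<subseteq> \<phi> K ` C"
  then obtain w\<^sub>0 where w\<^sub>0: "w\<^sub>0 \<in> C" "\<phi> K w\<^sub>0 \<in> D" unfolding saturated_def by blast
  have step: "\<phi> K v \<in> D"
    if "j \<in> J" "w \<in> C" "v \<in> C" "\<beta> j v = \<beta> j w" "\<phi> K w \<in> D" for j w v
  proof -
    have j: "j \<in> persons K" using that(1) persons_K by blast
    have "v \<in> {v \<in> \<Omega> X J. \<beta> j v = \<beta> j w}" using that C_subset_\<Omega> by blast
    then have "\<beta> j (\<phi> K v) = \<beta> j (\<phi> K w)"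
      using \<beta>_\<phi>[OF K j] class_in_part[OF that(1,2)] by blast
    then show ?thesis
      using saturated_\<Omega>_class[OF conjunct1[OF D] j that(5) \<phi>_K_in_\<Omega>[OF that(3)]] by blast
  qed
  have "\<phi> K ` C \<subseteq> D" by (rule pullback_eq_C[OF w\<^sub>0]) (erule (4) step)
  then show "D = \<phi> K ` C" using D by (intro equalityI) simp_all
qed

lemma surjective_image: "surjective_cell TYPE('s) X (persons K) (\<phi> K ` C)"
  unfolding surjective_cell_def
proof (intro allI impI)
  fix L :: "('s, 'j, 'x) kripke"
  assume "kripke_structure L \<and> props L = X \<and> persons L = persons K \<and> states L \<noteq> {} \<and>
    \<phi> L ` states L \<subseteq> \<phi> K ` C"
  then have L: "kripke_structure L" "props L = X" "persons L = persons K" "states L \<noteq> {}"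
    and sub: "\<phi> L ` states L \<subseteq> \<phi> K ` C" by blast+
  obtain s\<^sub>0 where s\<^sub>0: "s\<^sub>0 \<in> states L" using L(4) by blast
  obtain w\<^sub>0 where eq: "\<phi> L s\<^sub>0 = \<phi> K w\<^sub>0" and "w\<^sub>0 \<in> C"
    using subsetD[OF sub imageI[OF s\<^sub>0]] by (rule imageE)
  have w\<^sub>0: "w\<^sub>0 \<in> C" "\<phi> K w\<^sub>0 \<in> \<phi> L ` states L"
    using \<open>w\<^sub>0 \<in> C\<close> imageI[OF s\<^sub>0, of "\<phi> L"] unfolding eq .
  have step: "\<phi> K v \<in> \<phi> L ` states L"
    if j: "j \<in> J" and wv: "w \<in> C" "v \<in> C" "\<beta> j v = \<beta> j w" and w: "\<phi> K w \<in> \<phi> L ` states L"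
    for j w v
  proof -
    let ?P = "{u \<in> \<Omega> X J. \<beta> j u = \<beta> j w}"
    have jK: "j \<in> persons K" using j persons_K by blast
    then have jL: "j \<in> persons L" using L(3) by simp
    have "finite (\<phi> K ` ?P)" using finite_class[OF j wv(1)] by simp
    then have cl: "{u \<in> \<Omega> X (persons K). \<beta> j u = \<beta> j (\<phi> K w)} = \<phi> K ` ?P"
      using \<phi>_class_finite[OF K jK class_in_part[OF j wv(1)]] props_K X_nonempty by simp
    obtain s where s: "\<phi> K w = \<phi> L s" "s \<in> states L" using w by (rule imageE)
    obtain P' where P': "P' \<in> part L j" "s \<in> P'" "P' \<subseteq> states L"
      by (rule kripke_memberE[OF L(1) jL s(2)])
    \<comment> \<open>The image of \<open>P'\<close> lies in a class known to be finite. Being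
      finite it is closed, so it is the whole class, and the competing structure cannot omit
      \<open>\<phi> K v\<close>.\<close>
    have "\<phi> L ` P' \<subseteq> {u \<in> \<Omega> X (persons K). \<beta> j u = \<beta> j (\<phi> K w)}"
    proof
      fix u assume "u \<in> \<phi> L ` P'"
      then obtain t where t: "u = \<phi> L t" "t \<in> P'" by (rule imageE)
      then have "t \<in> states L" using P'(3) by blast
      then have "u \<in> \<Omega> X (persons K)" using \<phi>_in_\<Omega>[OF L(1)] L(2,3) t(1) by simp
      moreover have "\<beta> j u = \<beta> j (\<phi> K w)"
        unfolding s(1) t(1) by (rule \<beta>_\<phi>[OF L(1) jL P'(1) t(2) P'(2)])
      ultimately show "u \<in> {u \<in> \<Omega> X (persons K). \<beta> j u = \<beta> j (\<phi> K w)}" by simp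
    qed
    then have "finite (\<phi> L ` P')" using \<open>finite (\<phi> K ` ?P)\<close> unfolding cl by (rule finite_subset)
    then have "{u \<in> \<Omega> X (persons K). \<beta> j u = \<beta> j (\<phi> L s)} = \<phi> L ` P'"
      using \<phi>_class_finite[OF L(1) jL P'(1,2)] L(2,3) X_nonempty by simp
    then have "\<phi> L ` P' = \<phi> K ` ?P" using cl s(1) by simp
    moreover have "v \<in> ?P" using wv C_subset_\<Omega> by blast
    ultimately have "\<phi> K v \<in> \<phi> L ` P'" by blast
    then show ?thesis using P'(3) by blast
  qed
  have "\<phi> K ` C \<subseteq> \<phi> L ` states L" by (rule pullback_eq_C[OF w\<^sub>0]) (erule (4) step)
  then show "\<phi> L ` states L = \<phi> K ` C" using sub by (intro equalityI)
qed

lemma hemicontinuous_part: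
  assumes "j \<in> J"
  shows "upper_hemicontinuous_partition (subtopology (\<Omega>_top X J) C) (part K j)"
    and "lower_hemicontinuous_partition (subtopology (\<Omega>_top X J) C) (part K j)"
  using hemicontinuous_restrict_\<Q>[OF X_nonempty saturated_C assms finite_class[OF assms]]
    part_K[OF assms] by simp_all

lemma \<alpha>_K_clopen:
  assumes upper: "\<And>j. j \<in> persons K - J \<Longrightarrow>
      upper_hemicontinuous_partition (subtopology (\<Omega>_top X J) C) (part K j)"
    and lower: "\<And>j. j \<in> persons K - J \<Longrightarrow>
      lower_hemicontinuous_partition (subtopology (\<Omega>_top X J) C) (part K j)"
    and f: "f \<in> lang X (persons K)"
  shows "openin (subtopology (\<Omega>_top X J) C) (\<alpha> K f) \<and>
    closedin (subtopology (\<Omega>_top X J) C) (\<alpha> K f)"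
proof (rule \<alpha>_clopen[OF K])
  let ?T = "subtopology (\<Omega>_top X J) C"
  have top: "topspace ?T = C"
    using C_subset_\<Omega> topspace_\<Omega>_top[OF X_nonempty] by auto
  then show "topspace ?T = states K" using states_K by simp
  show "upper_hemicontinuous_partition ?T (part K j)" if "j \<in> persons K" for j
    using upper[of j] hemicontinuous_part(1)[of j] that by blast
  show "lower_hemicontinuous_partition ?T (part K j)" if "j \<in> persons K" for j
    using lower[of j] hemicontinuous_part(2)[of j] that by blast
  show "f \<in> lang (props K) (persons K)" using f props_K by simp
  fix x assume "x \<in> props K"
  then have l: "Atom x \<in> lang X J" "Neg (Atom x) \<in> lang X J"
    using props_K by (simp_all add: lang_def)
  have "\<alpha> K (Atom x) = {w \<in> C. Atom x \<in> w}"
    using states_K val_K by auto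
  then have eq: "\<alpha> K (Atom x) = {w \<in> \<Omega> X J. Atom x \<in> w} \<inter> C" using C_subset_\<Omega> by blast
  have "C - \<alpha> K (Atom x) = {w \<in> \<Omega> X J. Neg (Atom x) \<in> w} \<inter> C"
    unfolding eq using C_subset_\<Omega> \<Omega>_Neg[OF _ l(1)] by blast
  then have "openin ?T (\<alpha> K (Atom x))" "openin ?T (C - \<alpha> K (Atom x))"
    using eq openin_\<Omega>_formula[OF l(1)] openin_\<Omega>_formula[OF l(2)]
    unfolding openin_subtopology by blast+
  then show "openin ?T (\<alpha> K (Atom x)) \<and> closedin ?T (\<alpha> K (Atom x))"
    unfolding closedin_def top eq by blast
qed

end

section \<open>Assembly of the three-person cell\<close>

theorem mainTheorem3:
  fixes X :: "'x set"
    and S C :: "('x, nat) fm set set"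
    and \<pi> :: "('x, nat) fm set \<Rightarrow> nat \<Rightarrow> bool"
    and z :: "('x, nat) fm set"
    and zs :: "nat \<Rightarrow> ('x, nat) fm set"
    and A :: "nat \<Rightarrow> nat \<Rightarrow> ('x, nat) fm set set"
    and \<P> :: "nat \<Rightarrow> ('x, nat) fm set set set"
    and \<A> :: "(('x, nat) fm set, nat, 'x) kripke"
  assumes "finite X" and "X \<noteq> {}"
    and S_def: "S = \<Omega> X {1, 2}"
    and "is_cell (\<Omega>_kripke X {1, 2}) C"
    and "\<not> centered X {1, 2} C"
    and "finite_fanout (\<Omega>_kripke X {1, 2}) C"
    and "\<Omega>_top X {1, 2} closure_of C = S"
    and "homeomorphic_map (\<Omega>_top X {1, 2}) cantor_top \<pi>"
    and "z \<in> C"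
    and "\<And>i. i \<ge> 1 \<Longrightarrow> zs i \<in> C"
    and "\<And>i. i \<ge> 1 \<Longrightarrow> first_coords \<pi> (2*i - 2) (zs i) = first_coords \<pi> (2*i - 2) z"
    and "\<And>i. i \<ge> 1 \<Longrightarrow> first_coords \<pi> (2*i) (zs i) \<noteq> first_coords \<pi> (2*i) z"
    and A_def: "A = A_set S \<pi> z zs"
    and "\<And>i. i \<ge> 1 \<Longrightarrow> partition_on (C \<inter> (\<Union>k\<in>{1..i}. A i k)) (\<P> i)"
    and "\<And>i. i \<ge> 1 \<Longrightarrow> upper_hemicontinuous_partition
           (subtopology (\<Omega>_top X {1, 2}) (C \<inter> (\<Union>k\<in>{1..i}. A i k))) (\<P> i)"
    and "\<And>i. i \<ge> 1 \<Longrightarrow> lower_hemicontinuous_partition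
           (subtopology (\<Omega>_top X {1, 2}) (C \<inter> (\<Union>k\<in>{1..i}. A i k))) (\<P> i)"
    and "\<And>i M. i \<ge> 1 \<Longrightarrow> M \<in> \<P> i \<Longrightarrow> card M = i"
    and "\<And>i M k. i \<ge> 1 \<Longrightarrow> M \<in> \<P> i \<Longrightarrow> k \<in> {1..i} \<Longrightarrow> \<exists>!w. w \<in> M \<inter> A i k"
    and \<A>_def: "\<A> = \<A>_kripke X C (third_partition \<P> z zs)"
  shows "\<exists>D. is_cell (\<Omega>_kripke X {1, 2, 3}) D \<and> bij_betw (\<phi> \<A>) C D \<and>
           surjective_cell TYPE('s) X {1, 2, 3} D \<and>
           \<not> finite_fanout (\<Omega>_kripke X {1, 2, 3}) D"
proof -
  let ?T = "\<Omega>_top X {1, 2 :: nat}"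
  have sat: "saturated (\<Omega>_kripke X {1, 2}) C" using assms(4) unfolding is_cell_def by blast
  have C: "C \<subseteq> \<Omega> X {1, 2}" using sat by (simp add: saturated_def \<Omega>_kripke_def)
  have top: "topspace ?T = S" using topspace_\<Omega>_top[OF assms(2)] S_def by simp
  have fin: "finite {v \<in> \<Omega> X {1, 2}. \<beta> j v = \<beta> j w}" if j: "j \<in> {1, 2}" and w: "w \<in> C" for j w
  proof -
    have "{v \<in> \<Omega> X {1, 2}. \<beta> j v = \<beta> j w} \<in> \<Q> X {1, 2} j" using w C unfolding \<Q>_def by blast
    moreover have "{v \<in> \<Omega> X {1, 2}. \<beta> j v = \<beta> j w} \<subseteq> C"
      using saturated_\<Omega>_class[OF sat j w] by blast
    moreover have "\<forall>P\<in>\<Q> X {1, 2} j. P \<subseteq> C \<longrightarrow> finite P"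
      using assms(6) j unfolding finite_fanout_def \<Omega>_kripke_def by auto
    ultimately show ?thesis by blast
  qed
  have A: "A_set (topspace ?T) \<pi> z zs = A" using top A_def by simp
  interpret cc: cylinder_construction ?T C \<pi> z zs \<P>
  proof (unfold_locales, unfold A)
    show "C \<subseteq> topspace ?T" using C top S_def by simp
  qed ((rule assms(8-12) assms(14-16,18); assumption)+)
  have \<A>: "states \<A> = C" "persons \<A> = {1, 2, 3}" "props \<A> = X"
    "part \<A> 3 = third_partition \<P> z zs"
    "\<And>j. j \<in> {1, 2} \<Longrightarrow> part \<A> j = restrict_partition (\<Q> X {1, 2} j) C"
    "\<And>w x. w \<in> C \<Longrightarrow> val \<A> w x \<longleftrightarrow> Atom x \<in> w"
    unfolding \<A>_def \<A>_kripke_def by (auto simp: \<Omega>_val_def)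
  have ks: "kripke_structure \<A>"
    unfolding kripke_structure_def
  proof
    fix j assume "j \<in> persons \<A>"
    then have "j = 3 \<or> j \<in> {1, 2}" using \<A>(2) by auto
    then show "partition_on (states \<A>) (part \<A> j)"
      using cc.partition_third partition_on_restrict_\<Q>[OF C, of j] \<A>(1,4,5) by auto
  qed
  interpret ce: cell_extension X "{1, 2}" C \<A>
    using assms(2,4) fin ks \<A>(1,2,3,5,6) by unfold_locales auto
  have clopen: "openin (subtopology ?T C) (\<alpha> \<A> f) \<and> closedin (subtopology ?T C) (\<alpha> \<A> f)"
    if "f \<in> lang X {1, 2, 3}" for f
    using that cc.upper_third cc.lower_third \<A>(2,4)
    by (intro ce.\<alpha>_K_clopen) auto
  have \<phi>\<Omega>: "\<phi> \<A> w \<in> \<Omega> X {1, 2, 3}" if "w \<in> C" for w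
    using ce.\<phi>_K_in_\<Omega>[OF that] \<A>(2) by simp
  have Z_part: "cc.Z \<in> part \<A> 3" unfolding \<A>(4) third_partition_def by blast
  \<comment> \<open>Closedness of the image of the infinite set \<open>Z\<close>. A formula
    \<open>f\<close> separating \<open>v\<close> from the image of \<open>z\<close> alone has a
    clopen extent, so it fails on a neighbourhood of \<open>z\<close> and thus at all
    \<open>zs k\<close> with \<open>k > N\<close>. A second formula \<open>g\<close> handles the
    finitely many others, and \<open>Conj f g\<close> fails on all of \<open>Z\<close>.\<close>
  have sep: "\<exists>f\<in>v. \<forall>u\<in>cc.Z. f \<notin> \<phi> \<A> u"
    if v: "v \<in> \<Omega> X {1, 2, 3}" "v \<notin> \<phi> \<A> ` cc.Z" for v
  proof -
    have "v \<notin> {\<phi> \<A> z}" using v(2) by blast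
    then obtain f where f: "f \<in> v" "f \<notin> \<phi> \<A> z"
      using \<Omega>_separate_finite[OF assms(2) _ _ v(1), of "{\<phi> \<A> z}"] \<phi>\<Omega>[OF assms(9)] by auto
    have fl: "f \<in> lang X {1, 2, 3}" by (rule \<Omega>_in_lang[OF v(1) f(1)])
    have "openin (subtopology ?T C) (C - \<alpha> \<A> f)"
      using clopen[OF fl] C top S_def unfolding closedin_def by (simp add: Int_absorb1)
    then obtain V where V: "openin ?T V" "C - \<alpha> \<A> f = V \<inter> C"
      unfolding openin_subtopology by blast
    have "z \<notin> \<alpha> \<A> f" using f(2) fl \<A>(2,3) unfolding \<phi>_def by simp
    then have "z \<in> V" using V(2) assms(9) by blast
    then obtain N where N: "\<And>k. N < k \<Longrightarrow> zs k \<in> V" using cc.zs_tendsto[OF V(1)] by blast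
    let ?F = "\<phi> \<A> ` zs ` {1..N}"
    have "zs ` {1..N} \<subseteq> cc.Z" by auto
    then have "v \<notin> ?F" using v(2) by (meson image_mono subsetD)
    moreover have "?F \<subseteq> \<Omega> X {1, 2, 3}" using \<phi>\<Omega> assms(10) by auto
    ultimately obtain g where g: "g \<in> v" "\<forall>t\<in>?F. g \<notin> t"
      using \<Omega>_separate_finite[OF assms(2) _ _ v(1), of ?F] by auto
    have gl: "g \<in> lang X {1, 2, 3}" by (rule \<Omega>_in_lang[OF v(1) g(1)])
    have "Conj f g \<in> v" using \<Omega>_Conj[OF v(1) fl gl] f(1) g(1) by blast
    moreover have "Conj f g \<notin> \<phi> \<A> u" if u: "u \<in> cc.Z" for u
    proof -
      have uC: "u \<in> C" using u cc.Z_subset by blast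
      have "f \<notin> \<phi> \<A> u \<or> g \<notin> \<phi> \<A> u"
      proof (cases "u = z")
        case True
        then show ?thesis using f(2) by simp
      next
        case False
        then obtain k where k: "1 \<le> k" "u = zs k" using u by auto
        show ?thesis
        proof (cases "k \<le> N")
          case True
          then show ?thesis using g(2) k by auto
        next
          case False
          then have "u \<notin> \<alpha> \<A> f" using N[of k] V(2) k(2) uC by auto
          then show ?thesis unfolding \<phi>_def by simp
        qed
      qed
      then show ?thesis using \<Omega>_Conj[OF \<phi>\<Omega>[OF uC] fl gl] by simp
    qed
    ultimately show ?thesis by (intro bexI[of _ "Conj f g"] ballI)
  qed
  have class_Z: "{v \<in> \<Omega> X {1, 2, 3}. \<beta> 3 v = \<beta> 3 (\<phi> \<A> w)} = \<phi> \<A> ` cc.Z" if "w \<in> cc.Z" for w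
  proof -
    have "3 \<in> persons \<A>" unfolding \<A>(2) by simp
    from \<phi>_class[OF ks this Z_part that, unfolded \<A>(2,3), OF sep] show ?thesis .
  qed
  \<comment> \<open>Finite information sets have closed images, and the only possible infinite one
    is \<open>Z\<close>, treated above.\<close>
  have cls: "{v \<in> \<Omega> X (persons \<A>). \<beta> j v = \<beta> j (\<phi> \<A> w)} = \<phi> \<A> ` P"
    if j: "j \<in> persons \<A>" and P: "P \<in> part \<A> j" "w \<in> P" for j P w
  proof (cases "finite P")
    case True
    then show ?thesis using \<phi>_class_finite[OF ks j P] \<A>(3) assms(2) by simp
  next
    case False
    have "j \<notin> {1, 2}"
    proof
      assume j12: "j \<in> {1, 2}"
      then obtain u where "u \<in> C" "P = {v \<in> \<Omega> X {1, 2}. \<beta> j v = \<beta> j u}"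
        using P(1) \<A>(5) restrict_\<Q>[OF sat j12] by auto
      then show False using fin[OF j12] False by simp
    qed
    then have j3: "j = 3" using j \<A>(2) by auto
    \<comment> \<open>Here \<open>1 \<le> i\<close> matters: infinite sets have \<open>card\<close>
      0, so only a positive value forces finiteness.\<close>
    have "finite M" if "1 \<le> i" "M \<in> \<P> i" for i M
      using assms(17)[OF that] that(1) by (intro card_ge_0_finite) simp
    then have "P = cc.Z"
      using P(1) False unfolding j3 \<A>(4) third_partition_def by auto
    then show ?thesis using class_Z P(2) j3 \<A>(2) by simp
  qed
  have "is_cell (\<Omega>_kripke X (persons \<A>)) (\<phi> \<A> ` C)"
    by (rule ce.is_cell_image) (erule (2) cls)
  then have cell: "is_cell (\<Omega>_kripke X {1, 2, 3}) (\<phi> \<A> ` C)"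
    unfolding \<A>(2) .
  \<comment> \<open>The class of person 3 through the image of \<open>z\<close> is the image of
    \<open>Z\<close>, infinite because \<open>zs\<close> and \<phi> are injective.\<close>
  have "\<not> finite_fanout (\<Omega>_kripke X {1, 2, 3}) (\<phi> \<A> ` C)"
  proof
    assume "finite_fanout (\<Omega>_kripke X {1, 2, 3}) (\<phi> \<A> ` C)"
    then have ff: "\<forall>P\<in>\<Q> X {1, 2, 3} 3. P \<subseteq> \<phi> \<A> ` C \<longrightarrow> finite P"
      unfolding finite_fanout_def \<Omega>_kripke_def by simp
    have "\<phi> \<A> ` cc.Z \<in> \<Q> X {1, 2, 3} 3"
      unfolding class_Z[OF insertI1, symmetric] \<Q>_def by (rule imageI) (rule \<phi>\<Omega>[OF assms(9)])
    from bspec[OF ff this] have "finite (\<phi> \<A> ` cc.Z)"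
      using image_mono[OF cc.Z_subset] by (rule HOL.mp)
    then have "finite cc.Z"
      by (rule finite_imageD) (rule inj_on_subset[OF ce.inj_\<phi>_K cc.Z_subset])
    then have "finite (zs ` {1..})" by simp
    then show False
      using finite_imageD[OF _ cc.inj_zs] infinite_Ici by blast
  qed
  moreover have "bij_betw (\<phi> \<A>) C (\<phi> \<A> ` C)"
    using ce.inj_\<phi>_K by (simp add: bij_betw_def)
  moreover have "surjective_cell TYPE('s) X {1, 2, 3} (\<phi> \<A> ` C)"
    using ce.surjective_image[where 's = 's] unfolding \<A>(2) .
  ultimately show ?thesis using cell by blast
qed

end
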